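(* Let $q\in\mathbb{R}$, $\delta>0$, $c\in L^2(0,1)$, let $N_0\in\mathbb{Z}_+$ satisfy $-\lambda_n+q<-\delta$ for all $n>N_0$, and assume $c_n=\langle c,\phi_n\rangle\ne0$ for $0\le n\le N_0$. Let $L_0\in\mathbb{R}^{N_0+1}$ and $K_0\in\mathbb{R}^{1\times(N_0+1)}$ be such that there exist symmetric positive definite $P_{\rm o},P_{\rm c}\in\mathbb{R}^{(N_0+1)\times(N_0+1)}$ with $P_{\rm o}(A_0-L_0C_0)+(A_0-L_0C_0)^TP_{\rm o}<-2\delta P_{\rm o}$ and $P_{\rm c}(A_0-B_0K_0)+(A_0-B_0K_0)^TP_{\rm c}<-2\delta P_{\rm c}$. Given $h>0$, let $P,S,R\in\mathbb{R}^{(N_0+1)\times(N_0+1)}$ be symmetric positive definite matrices such that $$\begin{bmatrix}\phi & -PL_0C_0-e^{-2\delta h}S\\ * & -e^{-2\delta h}(S+R)\end{bmatrix}+h^2\begin{bmatrix}(A_0-L_0C_0)^T\\ -C_0^TL_0^T\end{bmatrix}R\begin{bmatrix}A_0-L_0C_0 & -L_0C_0\end{bmatrix}<0,$$ where $\phi=P(A_0-L_0C_0)+(A_0-L_0C_0)^TP+2\delta P+(1-e^{-2\delta h})S$. Then, given $r>0$ and an integer $M>\frac rh$, there exists some $N_*$ such that for all integers $N>N_*$ the two matrix inequalities $$\begin{bmatrix}-\lambda_{N+1}+q+\delta+\tfrac{Q\|c\|_N^2}{2} & 1 & 1\\ 1 & -\tfrac{2\alpha}{\lambda_{N+1}} &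 0\\ 1&0&-\tfrac{2\alpha_1}{\lambda_{N+1}}\end{bmatrix}<0\qquad\text{and}\qquad \Psi_0+\Big(\frac{r}{M}\Big)^2\Lambda_0^TR_e\Lambda_0<0$$ (with $\Psi_0,\Lambda_0$ defined in the context) are feasible, i.e. there exist symmetric positive definite $P_0\in\mathbb{R}^{(N_0+1)\times(N_0+1)}$, $P_e,S_e,R_e\in\mathbb{R}^{M(N_0+1)\times M(N_0+1)}$ and scalars $Q,\alpha,\alpha_1>0$ satisfying both.
   Context: Notation. $\langle\cdot,\cdot\rangle$ is the inner product of $L^2(0,1)$; $\mathbb{Z}_+$ is the set of nonnegative integers; $\otimes$ is the Kronecker product; for symmetric matrices $X<0$ means negative definite and $*$ denotes blocks determined by symmetry; $\mathrm{col}$ denotes vertical stacking. $\lambda_n=n^2\pi^2$, $n\in\mathbb{Z}_+$; $\phi_0(x)=1$, $\phi_n(x)=\sqrt2\cos(n\pi x)$ for $n\ge1$. $b_0=1$, $b_n=(-1)^n\sqrt2$ for $n\ge1$; $c_n=\langle c,\phi_n\rangle$; $\|c\|_N^2=\sum_{n=N+1}^\infty c_n^2$. Here $N\ge N_0+1$ always. $A_0=\mathrm{diag}\{-\lambda_0+q,\dots,-\lambda_{N_0}+q\}$, $B_0=[b_0,\dots,b_{N_0}]^T$, $C_0=[c_0,\dots,c_{N_0}]$. LMI data: $\epsilon_M=e^{-2\delta r/M}$. $J_M(0)$ is the $M\times M$ upper-triangular Jordan block with zero diagonal (ones on the superdiagonal; $J_1(0)=0$). $$F_e=I_M\otimes(A_0-L_0C_0)+J_M(0)\otimes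 L_0C_0,\qquad G_e=-I_M\otimes L_0C_0+J_M(0)\otimes L_0C_0,$$ $\mathcal L_e=\mathrm{col}\{0_{(M-2)(N_0+1)\times1},L_0,-L_0\}$ for $M\ge2$ and $\mathcal L_e=-L_0$ for $M=1$; $\mathcal K_e=[K_0,\dots,K_0]\in\mathbb{R}^{1\times M(N_0+1)}$. Set $$\psi=P_0(A_0-B_0K_0)+(A_0-B_0K_0)^TP_0+2\delta P_0,$$ $$\Psi_0=\begin{bmatrix}\psi+\frac{2\alpha}{N\pi^2}K_0^TK_0 & P_0B_0\mathcal K_e & 0&0\\ *& P_eF_e+F_e^TP_e+2\delta P_e+(1-\epsilon_M)S_e+\frac{2\alpha_1}{N\pi^2}\mathcal K_e^T\mathcal K_e & P_eG_e-\epsilon_MS_e & P_e\mathcal L_e\\ *&*&-\epsilon_M(S_e+R_e)&0\\ *&*&*&-\epsilon_MQ\end{bmatrix},$$ $$\Lambda_0=[\,0,\ F_e,\ G_e,\ \mathcal L_e\,],$$ where the zero block of $\Lambda_0$ has $N_0+1$ columns. *)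

theory Defs
  imports "HOL-Analysis.Analysis" "Jordan_Normal_Form.Jordan_Normal_Form"
begin

definition L2_01 :: "(real \<Rightarrow> real) \<Rightarrow> bool" where
  "L2_01 f \<longleftrightarrow> f \<in> borel_measurable (lebesgue_on {0<..<1}) \<and>
     integrable (lebesgue_on {0<..<1}) (\<lambda>x. (f x)\<^sup>2)"

definition inner_L2 :: "(real \<Rightarrow> real) \<Rightarrow> (real \<Rightarrow> real) \<Rightarrow> real" where
  "inner_L2 f g = integral\<^sup>L (lebesgue_on {0<..<1}) (\<lambda>x. f x * g x)"

definition lam :: "nat \<Rightarrow> real" where
  "lam n = (real n)\<^sup>2 * pi\<^sup>2"

definition phi :: "nat \<Rightarrow> real \<Rightarrow> real" where
  "phi n x = (if n = 0 then 1 else sqrt 2 * cos (real n * pi * x))"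

definition b_coeff :: "nat \<Rightarrow> real" where
  "b_coeff n = (if n = 0 then 1 else (- 1) ^ n * sqrt 2)"

definition c_coeff :: "(real \<Rightarrow> real) \<Rightarrow> nat \<Rightarrow> real" where
  "c_coeff c n = inner_L2 c (phi n)"

definition tail_norm_sq :: "(real \<Rightarrow> real) \<Rightarrow> nat \<Rightarrow> real" where
  "tail_norm_sq c N = (\<Sum>n. (c_coeff c (N + 1 + n))\<^sup>2)"

definition A0 :: "real \<Rightarrow> nat \<Rightarrow> real mat" where
  "A0 q N0 = mat_diag (N0 + 1) (\<lambda>n. - lam n + q)"

definition B0 :: "nat \<Rightarrow> real mat" where
  "B0 N0 = Matrix.mat (N0 + 1) 1 (\<lambda>(i, j). b_coeff i)"

definition C0 :: "(real \<Rightarrow> real) \<Rightarrow> nat \<Rightarrow> real mat" where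
  "C0 c N0 = Matrix.mat 1 (N0 + 1) (\<lambda>(i, j). c_coeff c j)"

definition pos_def :: "nat \<Rightarrow> real mat \<Rightarrow> bool" where
  "pos_def n A \<longleftrightarrow> A \<in> carrier_mat n n \<and> A\<^sup>T = A \<and>
     (\<forall>v \<in> carrier_vec n. v \<noteq> 0\<^sub>v n \<longrightarrow> 0 < scalar_prod v (A *\<^sub>v v))"

definition neg_def :: "nat \<Rightarrow> real mat \<Rightarrow> bool" where
  "neg_def n A \<longleftrightarrow> A \<in> carrier_mat n n \<and> A\<^sup>T = A \<and>
     (\<forall>v \<in> carrier_vec n. v \<noteq> 0\<^sub>v n \<longrightarrow> scalar_prod v (A *\<^sub>v v) < 0)"

definition append_cols :: "real mat \<Rightarrow> real mat \<Rightarrow> real mat" (infixr \<open>@\<^sub>c\<close> 66) where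
  "A @\<^sub>c B = four_block_mat A B (0\<^sub>m 0 (dim_col A)) (0\<^sub>m 0 (dim_col B))"

definition kron :: "real mat \<Rightarrow> real mat \<Rightarrow> real mat" (infixl \<open>\<otimes>\<^sub>K\<close> 72) where
  "A \<otimes>\<^sub>K B = Matrix.mat (dim_row A * dim_row B) (dim_col A * dim_col B)
     (\<lambda>(i, j). A $$ (i div dim_row B, j div dim_col B) * B $$ (i mod dim_row B, j mod dim_col B))"

text \<open>In the following definitions the matrix arguments \<open>A B C L K\<close> are to be instantiated with
  \<open>A0 q N0\<close>, \<open>B0 N0\<close>, \<open>C0 c N0\<close> and the gains \<open>L0\<close> (a column) and \<open>K0\<close> (a row), so that
  \<open>dim_row A = N0 + 1\<close>. Blocks given as \<open>*\<close> (determined by symmetry) are written out as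
  transposes.\<close>

definition delay_LMI :: "real \<Rightarrow> real \<Rightarrow> real mat \<Rightarrow> real mat \<Rightarrow> real mat \<Rightarrow>
    real mat \<Rightarrow> real mat \<Rightarrow> real mat \<Rightarrow> real mat" where
  "delay_LMI \<delta> h A L C P S R =
    (let e = exp (- 2 * \<delta> * h);
         \<phi> = P * (A - L * C) + (A - L * C)\<^sup>T * P + (2 * \<delta>) \<cdot>\<^sub>m P + (1 - e) \<cdot>\<^sub>m S;
         X = - (P * L * C) - e \<cdot>\<^sub>m S
     in four_block_mat
          \<phi>    X
          (X\<^sup>T) (- (e \<cdot>\<^sub>m (S + R)))
        + h\<^sup>2 \<cdot>\<^sub>m (((A - L * C)\<^sup>T @\<^sub>r (- (C\<^sup>T * L\<^sup>T))) * R * ((A - L * C) @\<^sub>c (- (L * C)))))"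

definition eps :: "real \<Rightarrow> real \<Rightarrow> nat \<Rightarrow> real" where
  "eps \<delta> r M = exp (- 2 * \<delta> * r / real M)"

definition F_e :: "nat \<Rightarrow> real mat \<Rightarrow> real mat \<Rightarrow> real mat \<Rightarrow> real mat" where
  "F_e M A L C = 1\<^sub>m M \<otimes>\<^sub>K (A - L * C) + jordan_block M 0 \<otimes>\<^sub>K (L * C)"

definition G_e :: "nat \<Rightarrow> real mat \<Rightarrow> real mat \<Rightarrow> real mat" where
  "G_e M L C = - (1\<^sub>m M \<otimes>\<^sub>K (L * C)) + jordan_block M 0 \<otimes>\<^sub>K (L * C)"

text \<open>The case \<open>M = 0\<close>, where the truncated subtraction would give a wrong dimension, is not used:
  the number of blocks is always positive.\<close>

definition L_e :: "nat \<Rightarrow> real mat \<Rightarrow> real mat" where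
  "L_e M L = (if M = 1 then - L else 0\<^sub>m ((M - 2) * dim_row L) 1 @\<^sub>r L @\<^sub>r (- L))"

definition K_e :: "nat \<Rightarrow> real mat \<Rightarrow> real mat" where
  "K_e M K = Matrix.mat 1 (M * dim_col K) (\<lambda>(i, j). K $$ (0, j mod dim_col K))"

definition Psi0 :: "real \<Rightarrow> real \<Rightarrow> nat \<Rightarrow> nat \<Rightarrow>
    real mat \<Rightarrow> real mat \<Rightarrow> real mat \<Rightarrow> real mat \<Rightarrow> real mat \<Rightarrow>
    real mat \<Rightarrow> real mat \<Rightarrow> real mat \<Rightarrow> real mat \<Rightarrow> real \<Rightarrow> real \<Rightarrow> real \<Rightarrow> real mat" where
  "Psi0 \<delta> r M N A B C L K P\<^sub>0 P\<^sub>e S\<^sub>e R\<^sub>e Q \<alpha> \<alpha>\<^sub>1 =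
    (let n = dim_row A;
         \<epsilon> = eps \<delta> r M;
         F = F_e M A L C;
         G = G_e M L C;
         \<psi> = P\<^sub>0 * (A - B * K) + (A - B * K)\<^sup>T * P\<^sub>0 + (2 * \<delta>) \<cdot>\<^sub>m P\<^sub>0;
         X11 = \<psi> + (2 * \<alpha> / (real N * pi\<^sup>2)) \<cdot>\<^sub>m (K\<^sup>T * K);
         X12 = P\<^sub>0 * B * K_e M K;
         X22 = P\<^sub>e * F + F\<^sup>T * P\<^sub>e + (2 * \<delta>) \<cdot>\<^sub>m P\<^sub>e + (1 - \<epsilon>) \<cdot>\<^sub>m S\<^sub>e
               + (2 * \<alpha>\<^sub>1 / (real N * pi\<^sup>2)) \<cdot>\<^sub>m ((K_e M K)\<^sup>T * K_e M K);
         X23 = P\<^sub>e * G - \<epsilon> \<cdot>\<^sub>m S\<^sub>e;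
         X24 = P\<^sub>e * L_e M L;
         X33 = - (\<epsilon> \<cdot>\<^sub>m (S\<^sub>e + R\<^sub>e));
         X44 = (- \<epsilon> * Q) \<cdot>\<^sub>m 1\<^sub>m 1
     in (X11             @\<^sub>c X12             @\<^sub>c 0\<^sub>m n (M * n)       @\<^sub>c 0\<^sub>m n 1)
     @\<^sub>r (X12\<^sup>T           @\<^sub>c X22             @\<^sub>c X23                @\<^sub>c X24)
     @\<^sub>r (0\<^sub>m (M * n) n    @\<^sub>c X23\<^sup>T           @\<^sub>c X33                @\<^sub>c 0\<^sub>m (M * n) 1)
     @\<^sub>r (0\<^sub>m 1 n          @\<^sub>c X24\<^sup>T           @\<^sub>c 0\<^sub>m 1 (M * n)       @\<^sub>c X44))"

definition Lambda0 :: "nat \<Rightarrow> real mat \<Rightarrow> real mat \<Rightarrow> real mat \<Rightarrow> real mat" where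
  "Lambda0 M A L C =
     0\<^sub>m (M * dim_row A) (dim_row A) @\<^sub>c F_e M A L C @\<^sub>c G_e M L C @\<^sub>c L_e M L"

definition tail_LMI :: "real \<Rightarrow> real \<Rightarrow> (real \<Rightarrow> real) \<Rightarrow> nat \<Rightarrow> real \<Rightarrow> real \<Rightarrow> real \<Rightarrow> real mat" where
  "tail_LMI q \<delta> c N Q \<alpha> \<alpha>\<^sub>1 = mat_of_rows_list 3
    [[- lam (N + 1) + q + \<delta> + Q * tail_norm_sq c N / 2, 1, 1],
     [1, - (2 * \<alpha> / lam (N + 1)), 0],
     [1, 0, - (2 * \<alpha>\<^sub>1 / lam (N + 1))]]"

end

theory Submission
  imports Defs
begin

text \<open>
  Write \<open>D = A - L C\<close>, \<open>E = L C\<close> and \<open>\<tau> = r / M\<close>.  All inequalities are treated as statements about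
  quadratic forms.  The form of the single-delay inequality at \<open>(x, y)\<close> is
  \<open>dform \<delta> e \<tau> P S R x y f\<close> with \<open>f = D x - E y\<close> (lemma \<open>delay_LMI_form\<close>); it decreases when the delay
  decreases from \<open>h\<close> to \<open>\<tau> < h\<close>, so the given \<open>P, S, R\<close> also serve for \<open>\<tau>\<close>
  (\<open>delay_LMI_coercive\<close>).

  The closed-loop form at \<open>(x, z, w, u)\<close> contains the same expression \<open>dform\<close> with the large matrices
  \<open>P\<^sub>e, S\<^sub>e, R\<^sub>e\<close> and \<open>f = F\<^sub>e z + G\<^sub>e w + \<L>\<^sub>e u\<close> (\<open>\<Omega>_form\<close>).  Split into \<open>M\<close> blocks, the \<open>i\<close>-th block of
  \<open>f\<close> is \<open>D z\<^sub>i - E w\<^sub>i + p\<^sub>i\<close>, where \<open>p\<^sub>i\<close> depends only on block \<open>i + 1\<close> and on \<open>u\<close> (\<open>blk_cascade\<close>).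
  The subpredictors thus form a cascade driven from its last block, and block-diagonal
  \<open>P\<^sub>e, S\<^sub>e, R\<^sub>e\<close> with blocks \<open>\<sigma>\<^sup>i P, \<sigma>\<^sup>i S, \<sigma>\<^sup>i R\<close> make the whole sum negative up to a
  multiple of \<open>\<bar>u\<bar>\<^sup>2\<close>, provided that \<open>\<sigma>\<close> is large: the gain \<open>\<sigma>\<close> from one block to the next absorbs the
  coupling (\<open>dform_cascade\<close>).

  It remains to choose \<open>P\<^sub>0\<close> as a small multiple of a solution of the Lyapunov inequality for
  \<open>A - B K\<close>, so that the cross term between \<open>x\<close> and \<open>z\<close> is absorbed, \<open>Q\<close> large to absorb \<open>\<bar>u\<bar>\<^sup>2\<close>, and
  \<open>N\<close> large, since the remaining terms carry a factor \<open>1 / N\<close> (\<open>loop_LMI_feasible\<close>).  None of these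
  choices except the last involves \<open>N\<close>; with \<open>\<alpha> = \<alpha>\<^sub>1 = 4\<close> the first inequality reduces to
  \<open>- \<lambda>\<^sub>N\<^sub>+\<^sub>1 / 2 + q + \<delta> + Q \<parallel>c\<parallel>\<^sub>N\<^sup>2 / 2 < 0\<close> (\<open>tail_LMI_neg_def\<close>), which holds for large \<open>N\<close> because
  \<open>\<parallel>c\<parallel>\<^sub>N\<^sup>2\<close> is bounded by Bessel's inequality (\<open>tail_norm_sq_le\<close>).
\<close>

(* \<bullet> and $ denote the operations on vectors of variable dimension. *)
unbundle no inner_syntax
unbundle no vec_syntax

section \<open>Vector and matrix identities under dimension conditions\<close>

text \<open>The identities of this section restate matrix algebra with side conditions that are equations
  between dimensions, in place of membership in carrier sets.  The simplifier can then discharge the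
  conditions for compound matrices without guessing intermediate dimensions.\<close>

lemma sp_sum: "v \<bullet> w = (\<Sum>i<dim_vec w. v $ i * w $ i)" for v w :: "real vec"
  by (simp add: scalar_prod_def atLeast0LessThan)

lemma sp_comm: "dim_vec v = dim_vec w \<Longrightarrow> v \<bullet> w = w \<bullet> v" for v w :: "real vec"
  by (simp add: sp_sum mult.commute)

lemma sp_add_right: "dim_vec b = dim_vec c \<Longrightarrow> a \<bullet> (b + c) = a \<bullet> b + a \<bullet> c" for a b c :: "real vec"
  by (simp add: sp_sum algebra_simps sum.distrib)

lemma sp_add_left: "dim_vec a = dim_vec c \<Longrightarrow> dim_vec b = dim_vec c \<Longrightarrow> (a + b) \<bullet> c = a \<bullet> c + b \<bullet> c"
  for a b c :: "real vec"
  by (simp add: sp_sum algebra_simps sum.distrib)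

lemma sp_minus_right: "dim_vec b = dim_vec c \<Longrightarrow> a \<bullet> (b - c) = a \<bullet> b - a \<bullet> c" for a b c :: "real vec"
  by (simp add: sp_sum algebra_simps sum_subtractf)

lemma sp_minus_left: "dim_vec a = dim_vec c \<Longrightarrow> dim_vec b = dim_vec c \<Longrightarrow> (a - b) \<bullet> c = a \<bullet> c - b \<bullet> c"
  for a b c :: "real vec"
  by (simp add: sp_sum algebra_simps sum_subtractf)

lemma sp_uminus_right: "a \<bullet> (- b) = - (a \<bullet> b)" for a b :: "real vec"
  by (simp add: sp_sum sum_negf)

lemma sp_uminus_left: "dim_vec a = dim_vec b \<Longrightarrow> (- a) \<bullet> b = - (a \<bullet> b)" for a b :: "real vec"
  by (simp add: sp_sum sum_negf)

lemma sp_zero [simp]: "v \<bullet> 0\<^sub>v n = 0" for v :: "real vec"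
  by (simp add: sp_sum)

lemma mv_index: "i < dim_row A \<Longrightarrow> dim_vec v = dim_col A \<Longrightarrow>
    (A *\<^sub>v v) $ i = (\<Sum>j<dim_col A. A $$ (i, j) * v $ j)" for v :: "real vec"
  by (simp add: sp_sum)

lemma mv_add: "dim_vec x = dim_col A \<Longrightarrow> dim_vec y = dim_col A \<Longrightarrow>
    A *\<^sub>v (x + y) = A *\<^sub>v x + A *\<^sub>v y" for x :: "real vec"
  by (intro eq_vecI) (simp_all add: sp_add_right)

lemma mv_minus: "dim_vec x = dim_col A \<Longrightarrow> dim_vec y = dim_col A \<Longrightarrow>
    A *\<^sub>v (x - y) = A *\<^sub>v x - A *\<^sub>v y" for x :: "real vec"
  by (intro eq_vecI) (simp_all add: sp_minus_right)

lemma mv_uminus: "A *\<^sub>v (- x) = - (A *\<^sub>v x)" for x :: "real vec"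
  by (intro eq_vecI) (simp_all add: sp_uminus_right)

lemma mv_smult: "A *\<^sub>v (k \<cdot>\<^sub>v x) = k \<cdot>\<^sub>v (A *\<^sub>v x)" if "dim_vec x = dim_col A" for x :: "real vec"
  using that by (intro eq_vecI) (simp_all)

lemma add_mv: "dim_row A = dim_row B \<Longrightarrow> dim_col A = dim_col B \<Longrightarrow> dim_vec x = dim_col B \<Longrightarrow>
    (A + B) *\<^sub>v x = A *\<^sub>v x + B *\<^sub>v x" for x :: "real vec"
  by (intro eq_vecI) (simp_all add: sp_sum algebra_simps sum.distrib)

lemma minus_mv: "dim_row A = dim_row B \<Longrightarrow> dim_col A = dim_col B \<Longrightarrow> dim_vec x = dim_col B \<Longrightarrow>
    (A - B) *\<^sub>v x = A *\<^sub>v x - B *\<^sub>v x" for x :: "real vec"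
  by (intro eq_vecI) (simp_all add: sp_sum algebra_simps sum_subtractf)

lemma uminus_mv: "dim_vec x = dim_col A \<Longrightarrow> (- A) *\<^sub>v x = - (A *\<^sub>v x)" for x :: "real vec"
  by (intro eq_vecI) (simp_all add: sp_sum sum_negf)

lemma smult_mv: "dim_vec x = dim_col A \<Longrightarrow> (k \<cdot>\<^sub>m A) *\<^sub>v x = k \<cdot>\<^sub>v (A *\<^sub>v x)" for x :: "real vec"
  by (intro eq_vecI) (simp_all)

lemma mult_mv: "dim_col A = dim_row B \<Longrightarrow> dim_vec x = dim_col B \<Longrightarrow> (A * B) *\<^sub>v x = A *\<^sub>v (B *\<^sub>v x)"
  for x :: "real vec"
  by (rule assoc_mult_mat_vec[of A "dim_row A" "dim_row B" B "dim_col B"]) (auto intro: carrier_vecI)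

lemma zero_mv: "dim_vec x = m \<Longrightarrow> 0\<^sub>m n m *\<^sub>v x = 0\<^sub>v n" for x :: "real vec"
  by (intro eq_vecI) (simp_all add: sp_sum)

lemma one_mv: "dim_vec x = n \<Longrightarrow> 1\<^sub>m n *\<^sub>v x = x" for x :: "real vec"
  by (rule one_mult_mat_vec) (auto intro: carrier_vecI)

lemma sp_transpose: "dim_vec x = dim_row A \<Longrightarrow> dim_vec y = dim_col A \<Longrightarrow> y \<bullet> (A\<^sup>T *\<^sub>v x) = x \<bullet> (A *\<^sub>v y)"
  for x y :: "real vec"
  using transpose_vec_mult_scalar[of A "dim_row A" "dim_col A" y x]
  by (metis carrier_matI carrier_vecI dim_mult_mat_vec index_transpose_mat(2) sp_comm)

lemma sp_append: "dim_vec v1 = dim_vec w1 \<Longrightarrow> dim_vec v2 = dim_vec w2 \<Longrightarrow>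
    (v1 @\<^sub>v v2) \<bullet> (w1 @\<^sub>v w2) = v1 \<bullet> w1 + v2 \<bullet> w2" for v1 v2 w1 w2 :: "real vec"
  by (rule scalar_prod_append) (auto intro: carrier_vecI)

lemma append_rows_mv: "dim_col A = dim_col B \<Longrightarrow> dim_vec v = dim_col B \<Longrightarrow>
    (A @\<^sub>r B) *\<^sub>v v = (A *\<^sub>v v) @\<^sub>v (B *\<^sub>v v)" for v :: "real vec"
  by (rule mat_mult_append[of _ "dim_row A" "dim_col A"]) (auto intro: carrier_vecI)

lemma append_cols_mv: "dim_row A = dim_row B \<Longrightarrow> dim_vec a = dim_col A \<Longrightarrow> dim_vec b = dim_col B \<Longrightarrow>
    (A @\<^sub>c B) *\<^sub>v (a @\<^sub>v b) = A *\<^sub>v a + B *\<^sub>v b" for a b :: "real vec"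
  unfolding append_cols_def
  by (subst four_block_mat_mult_vec[of _ "dim_row A" "dim_col A" _ "dim_col B" _ 0])
    (auto intro!: carrier_vecI eq_vecI)

lemma four_block_mv: "dim_row B = dim_row A \<Longrightarrow> dim_col C = dim_col A \<Longrightarrow> dim_row C = dim_row D \<Longrightarrow>
    dim_col B = dim_col D \<Longrightarrow> dim_vec a = dim_col A \<Longrightarrow> dim_vec d = dim_col D \<Longrightarrow>
    four_block_mat A B C D *\<^sub>v (a @\<^sub>v d) = (A *\<^sub>v a + B *\<^sub>v d) @\<^sub>v (C *\<^sub>v a + D *\<^sub>v d)" for a d :: "real vec"
  by (rule four_block_mat_mult_vec[of _ "dim_row A" "dim_col A" _ "dim_col D" _ "dim_row D"])
   (auto intro: carrier_vecI)

lemma dim_append_rows [simp]: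
  "dim_row (A @\<^sub>r B) = dim_row A + dim_row B" "dim_col (A @\<^sub>r B) = dim_col A"
  by (simp_all add: append_rows_def)

lemma dim_append_cols [simp]:
  "dim_row (A @\<^sub>c B) = dim_row A" "dim_col (A @\<^sub>c B) = dim_col A + dim_col B"
  by (simp_all add: append_cols_def)

lemma dim_kron [simp]:
  "dim_row (A \<otimes>\<^sub>K B) = dim_row A * dim_row B" "dim_col (A \<otimes>\<^sub>K B) = dim_col A * dim_col B"
  by (simp_all add: kron_def)

lemma append_vec_exhaust:
  assumes "dim_vec v = n + m"
  obtains a b where "v = a @\<^sub>v b" "dim_vec a = n" "dim_vec b = m"
  by (metis assms carrier_vecD carrier_vecI vec_first_carrier vec_first_last_append vec_last_carrier)

lemmas mv_simps = mv_add mv_minus mv_uminus mv_smult add_mv minus_mv uminus_mv smult_mv mult_mv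
  zero_mv one_mv
lemmas sp_simps = sp_add_right sp_add_left sp_minus_right sp_minus_left sp_uminus_right sp_uminus_left

section \<open>Squared norms\<close>

text \<open>The squared Euclidean norm.\<close>

definition nsq :: "real vec \<Rightarrow> real" where
  "nsq v = v \<bullet> v"

lemma nsq_sum: "nsq v = (\<Sum>i<dim_vec v. (v $ i)\<^sup>2)"
  by (simp add: nsq_def sp_sum power2_eq_square)

lemma nsq_ge_0 [simp]: "0 \<le> nsq v"
  by (simp add: nsq_sum sum_nonneg)

lemma nsq_eq_0_iff: "nsq v = 0 \<longleftrightarrow> v = 0\<^sub>v (dim_vec v)"
proof -
  have "nsq v = 0 \<longleftrightarrow> (\<forall>i<dim_vec v. v $ i = 0)"
    by (auto simp: nsq_sum sum_nonneg_eq_0_iff)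
  then show ?thesis
    by (metis eq_vecI index_zero_vec)
qed

lemma nsq_append: "nsq (v @\<^sub>v w) = nsq v + nsq w"
  by (simp add: nsq_def sp_append)

lemma nsq_zero [simp]: "nsq (0\<^sub>v n) = 0"
  by (simp add: nsq_def)

lemma nsq_uminus [simp]: "nsq (- v) = nsq v"
  by (simp add: nsq_def sp_simps)

lemma nsq_add_le:
  assumes "dim_vec v = dim_vec w"
  shows "nsq (v + w) \<le> 2 * nsq v + 2 * nsq w"
proof -
  have "(v $ i + w $ i)\<^sup>2 \<le> 2 * (v $ i)\<^sup>2 + 2 * (w $ i)\<^sup>2" for i
    using sum_squares_bound[of "v $ i" "w $ i"] by (simp add: power2_sum)
  then have "(\<Sum>i<dim_vec w. (v $ i + w $ i)\<^sup>2) \<le> (\<Sum>i<dim_vec w. 2 * (v $ i)\<^sup>2 + 2 * (w $ i)\<^sup>2)"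
    by (intro sum_mono) blast
  then show ?thesis
    using assms by (simp add: nsq_sum sum.distrib sum_distrib_left)
qed

text \<open>Young's inequality, by which every cross term is absorbed into squared norms.\<close>

lemma young:
  assumes "dim_vec v = dim_vec w" "t > 0"
  shows "2 * (v \<bullet> w) \<le> t * nsq v + nsq w / t"
proof -
  have "2 * (a * b) \<le> t * a\<^sup>2 + b\<^sup>2 / t" for a b :: real
  proof -
    have "0 \<le> (t * a - b)\<^sup>2 / t"
      using assms by simp
    also have "\<dots> = t * a\<^sup>2 + b\<^sup>2 / t - 2 * (a * b)"
      using assms by (simp add: power2_diff field_simps power2_eq_square)
    finally show ?thesis by simp
  qed
  then have "(\<Sum>i<dim_vec w. 2 * (v $ i * w $ i)) \<le> (\<Sum>i<dim_vec w. t * (v $ i)\<^sup>2 + (w $ i)\<^sup>2 / t)"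
    by (intro sum_mono) blast
  then show ?thesis
    using assms by (simp add: nsq_sum sp_sum sum.distrib sum_distrib_left sum_divide_distrib)
qed

text \<open>The squared Frobenius norm, which serves as a crude bound for the squared operator norm.\<close>

definition frob :: "real mat \<Rightarrow> real" where
  "frob X = (\<Sum>i<dim_row X. nsq (row X i))"

lemma frob_ge_0 [simp]: "0 \<le> frob X"
  by (simp add: frob_def sum_nonneg)

lemma nsq_mv_le:
  assumes "dim_vec x = dim_col X"
  shows "nsq (X *\<^sub>v x) \<le> frob X * nsq x"
proof -
  have "nsq (X *\<^sub>v x) = (\<Sum>i<dim_row X. (row X i \<bullet> x)\<^sup>2)"
    by (simp add: nsq_sum)
  also have "\<dots> \<le> (\<Sum>i<dim_row X. nsq (row X i) * nsq x)"
  proof (rule sum_mono)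
    fix i
    have "(\<Sum>j<dim_vec x. row X i $ j * x $ j)\<^sup>2
        \<le> (\<Sum>j<dim_vec x. (row X i $ j)\<^sup>2) * (\<Sum>j<dim_vec x. (x $ j)\<^sup>2)"
      by (rule Cauchy_Schwarz_ineq_sum)
    then show "(row X i \<bullet> x)\<^sup>2 \<le> nsq (row X i) * nsq x"
      by (simp add: sp_sum nsq_sum assms)
  qed
  finally show ?thesis
    by (simp add: frob_def sum_distrib_right)
qed

text \<open>A negative definite form is bounded by a negative multiple of the squared norm, since it attains
  its maximum on the unit sphere.  As the dimension \<open>n\<close> is a number, not a type, the sphere is taken in
  the product space of all functions on the naturals, inside a compact product of intervals whose
  factors beyond \<open>n\<close> are trivial.\<close>

lemma neg_def_coercive:
  assumes "neg_def n A"
  obtains \<kappa> where "\<kappa> > 0" "\<And>v. dim_vec v = n \<Longrightarrow> v \<bullet> (A *\<^sub>v v) \<le> - \<kappa> * nsq v"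
proof (cases "n = 0")
  case True
  show thesis
  proof (rule that[of 1])
    fix v :: "real vec" assume "dim_vec v = n"
    moreover have "dim_row A = 0"
      using assms True by (auto simp: neg_def_def)
    ultimately show "v \<bullet> (A *\<^sub>v v) \<le> - 1 * nsq v"
      using True by (simp add: nsq_sum sp_sum)
  qed simp
next
  case False
  have A: "dim_row A = n" "dim_col A = n"
    and neg: "\<And>v. dim_vec v = n \<Longrightarrow> v \<noteq> 0\<^sub>v n \<Longrightarrow> v \<bullet> (A *\<^sub>v v) < 0"
    using assms unfolding neg_def_def by (blast intro: carrier_vecI)+
  define q where "q f = (\<Sum>i<n. f i * (\<Sum>j<n. A $$ (i, j) * f j))" for f :: "nat \<Rightarrow> real"
  have q: "v \<bullet> (A *\<^sub>v v) = q (\<lambda>i. v $ i)" if "dim_vec v = n" for v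
    using that by (simp add: sp_sum[of v] mv_index A q_def del: index_mult_mat_vec)
  define K where "K = PiE UNIV (\<lambda>i. if i < n then {-1..1::real} else {0})"
  have coord: "continuous_on X (\<lambda>f::nat \<Rightarrow> real. f i)" for X i
    by (rule continuous_on_subset[OF continuous_on_product_coordinates]) simp
  define S where "S = K \<inter> {f. (\<Sum>i<n. (f i)\<^sup>2) = 1}"
  have "compactin (product_topology (\<lambda>_. euclidean) UNIV) K"
    unfolding K_def by (subst compactin_PiE) auto
  then have "compact K"
    by (simp add: euclidean_product_topology)
  moreover have "closed {f::nat \<Rightarrow> real. (\<Sum>i<n. (f i)\<^sup>2) = 1}"
    by (intro closed_Collect_eq continuous_on_const continuous_on_sum continuous_on_power coord)
  ultimately have "compact S"
    unfolding S_def by (rule compact_Int_closed)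
  moreover have "S \<noteq> {}"
  proof -
    have "(\<lambda>i. if i = 0 then 1 else 0) \<in> S"
      using False by (auto simp: S_def K_def if_distrib[of "\<lambda>x. x ^ 2"] cong: if_cong)
    then show ?thesis by blast
  qed
  moreover have "continuous_on S q"
    unfolding q_def
    by (intro continuous_on_sum continuous_on_mult continuous_on_const coord)
  ultimately obtain f where f: "f \<in> S" "\<And>g. g \<in> S \<Longrightarrow> q g \<le> q f"
    by (metis continuous_attains_sup)
  have "q f < 0"
  proof -
    let ?v = "Matrix.vec n f"
    have "nsq ?v = 1"
      using f(1) by (simp add: nsq_sum S_def)
    then have "?v \<noteq> 0\<^sub>v n"
      by (metis nsq_zero zero_neq_one)
    then have "?v \<bullet> (A *\<^sub>v ?v) < 0"
      by (intro neg) auto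
    also have "?v \<bullet> (A *\<^sub>v ?v) = q (\<lambda>i. ?v $ i)"
      by (rule q) simp
    also have "\<dots> = q f"
      by (simp add: q_def)
    finally show ?thesis .
  qed
  show thesis
  proof (rule that[of "- q f"])
    show "- q f > 0" using \<open>q f < 0\<close> by simp
    fix v :: "real vec" assume v: "dim_vec v = n"
    show "v \<bullet> (A *\<^sub>v v) \<le> - (- q f) * nsq v"
    proof (cases "nsq v = 0")
      case True
      then have "v = 0\<^sub>v n" using v nsq_eq_0_iff by metis
      then show ?thesis by (simp add: sp_sum)
    next
      case False
      define t where "t = sqrt (nsq v)"
      have t: "t > 0" "t\<^sup>2 = nsq v"
        using False nsq_ge_0[of v] unfolding t_def by (simp_all del: nsq_ge_0)
      \<comment> \<open>\<open>v\<close> scaled to the unit sphere\<close>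
      define g where "g i = (if i < n then v $ i / t else 0)" for i
      have one: "(\<Sum>i<n. (g i)\<^sup>2) = 1"
        using t False v by (simp add: g_def power_divide flip: sum_divide_distrib) (simp add: nsq_sum)
      have "\<bar>g i\<bar> \<le> 1" for i
      proof (cases "i < n")
        case True
        then have "(g i)\<^sup>2 \<le> (\<Sum>i<n. (g i)\<^sup>2)"
          by (intro member_le_sum) auto
        then show ?thesis using one by (simp add: abs_square_le_1)
      qed (simp add: g_def)
      then have "- 1 \<le> g i \<and> g i \<le> 1" for i
        using abs_le_iff[of "g i" 1] by (simp add: minus_le_iff)
      moreover have "g i = 0" if "\<not> i < n" for i
        using that by (simp add: g_def)
      ultimately have "g \<in> S"
        using one by (simp add: S_def K_def PiE_iff)
      then have "q g * t\<^sup>2 \<le> q f * t\<^sup>2"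
        using f(2) by (intro mult_right_mono) auto
      moreover have "q g * t\<^sup>2 = q (\<lambda>i. v $ i)"
        using t(1) by (simp add: q_def g_def sum_distrib_left sum_distrib_right power2_eq_square)
      ultimately show ?thesis
        using t q[OF v] by simp
    qed
  qed
qed

lemma nsq_minus_le:
  assumes "dim_vec v = dim_vec w"
  shows "nsq (v - w) \<le> 2 * nsq v + 2 * nsq w"
proof -
  have "v - w = v + (- w)"
    using assms by (intro eq_vecI) auto
  then show ?thesis
    using nsq_add_le[of v "- w"] assms by simp
qed

section \<open>Symmetric and positive definite matrices\<close>

lemma sym_square: "A\<^sup>T = A \<Longrightarrow> dim_col A = dim_row A" for A :: "real mat"
  using index_transpose_mat(2)[of A] by simp

lemma sp_sym: "A\<^sup>T = A \<Longrightarrow> dim_vec x = dim_row A \<Longrightarrow> dim_vec y = dim_row A \<Longrightarrow> x \<bullet> (A *\<^sub>v y) = y \<bullet> (A *\<^sub>v x)"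
  for x y :: "real vec"
  using sp_transpose[of y A x] sym_square[of A] by simp

lemma sym_add:
  fixes A B :: "real mat"
  assumes "A\<^sup>T = A" "B\<^sup>T = B" "dim_row A = dim_row B"
  shows "(A + B)\<^sup>T = A + B"
proof -
  have "A \<in> carrier_mat (dim_row B) (dim_row B)" "B \<in> carrier_mat (dim_row B) (dim_row B)"
    using assms(3) sym_square[OF assms(1)] sym_square[OF assms(2)] by (metis carrier_matI)+
  then have "(A + B)\<^sup>T = A\<^sup>T + B\<^sup>T"
    by (rule transpose_add)
  then show ?thesis
    by (simp only: assms)
qed

lemma sym_smult: "A\<^sup>T = A \<Longrightarrow> (k \<cdot>\<^sub>m A)\<^sup>T = k \<cdot>\<^sub>m A" for A :: "real mat"
proof -
  assume "A\<^sup>T = A"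
  moreover have "(k \<cdot>\<^sub>m A)\<^sup>T = k \<cdot>\<^sub>m A\<^sup>T"
    by (intro eq_matI) auto
  ultimately show ?thesis by simp
qed

lemma sym_uminus: "A\<^sup>T = A \<Longrightarrow> (- A)\<^sup>T = - A" for A :: "real mat"
proof -
  assume "A\<^sup>T = A"
  moreover have "(- A)\<^sup>T = - (A\<^sup>T)"
    by (intro eq_matI) auto
  ultimately show ?thesis by simp
qed

lemma sym_gram:
  fixes K :: "real mat"
  shows "(K\<^sup>T * K)\<^sup>T = K\<^sup>T * K"
proof -
  obtain n m where K: "K \<in> carrier_mat n m" by blast
  then have "K\<^sup>T \<in> carrier_mat m n" by simp
  from transpose_mult[OF this K] show ?thesis
    by (simp only: transpose_transpose)
qed

lemma sym_congruence:
  fixes X R :: "real mat"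
  assumes "R\<^sup>T = R" "dim_row X = dim_row R"
  shows "(X\<^sup>T * R * X)\<^sup>T = X\<^sup>T * R * X"
proof -
  obtain n m where c: "X \<in> carrier_mat n m" "R \<in> carrier_mat n n"
    using assms(2) sym_square[OF assms(1)] by blast
  have t: "X\<^sup>T \<in> carrier_mat m n" "X\<^sup>T * R \<in> carrier_mat m n"
    using c by simp_all
  have "(X\<^sup>T * R * X)\<^sup>T = X\<^sup>T * (X\<^sup>T * R)\<^sup>T"
    by (rule transpose_mult[OF t(2) c(1)])
  also have "(X\<^sup>T * R)\<^sup>T = R * X"
    by (simp add: transpose_mult[OF t(1) c(2)] assms(1))
  also have "X\<^sup>T * (R * X) = X\<^sup>T * R * X"
    by (rule assoc_mult_mat[OF t(1) c(2) c(1), symmetric])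
  finally show ?thesis .
qed

lemma sym_lyapunov:
  fixes P F :: "real mat"
  assumes "P\<^sup>T = P" "dim_row F = dim_row P" "dim_col F = dim_row P"
  shows "(P * F + F\<^sup>T * P)\<^sup>T = P * F + F\<^sup>T * P"
proof -
  obtain n where c: "P \<in> carrier_mat n n" "F \<in> carrier_mat n n"
    using assms(2,3) sym_square[OF assms(1)] by blast
  have t: "F\<^sup>T \<in> carrier_mat n n" "P * F \<in> carrier_mat n n" "F\<^sup>T * P \<in> carrier_mat n n"
    using c by simp_all
  have "(P * F + F\<^sup>T * P)\<^sup>T = (P * F)\<^sup>T + (F\<^sup>T * P)\<^sup>T"
    by (rule transpose_add[OF t(2,3)])
  also have "(P * F)\<^sup>T = F\<^sup>T * P"
    by (simp add: transpose_mult[OF c] assms(1))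
  also have "(F\<^sup>T * P)\<^sup>T = P * F"
    by (simp add: transpose_mult[OF t(1) c(1)] assms(1))
  also have "F\<^sup>T * P + P * F = P * F + F\<^sup>T * P"
    by (rule comm_add_mat[OF t(3,2)])
  finally show ?thesis .
qed

lemma sym_if_bilinear_sym:
  fixes A :: "real mat"
  assumes "dim_row A = n" "dim_col A = n"
    and "\<And>x y. dim_vec x = n \<Longrightarrow> dim_vec y = n \<Longrightarrow> x \<bullet> (A *\<^sub>v y) = y \<bullet> (A *\<^sub>v x)"
  shows "A\<^sup>T = A"
proof (rule eq_matI)
  have entry: "unit_vec n i \<bullet> (A *\<^sub>v unit_vec n j) = A $$ (i, j)" if "i < n" "j < n" for i j
    using that assms(1,2) by (subst scalar_prod_left_unit[of _ n]) (auto intro: carrier_vecI)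
  fix i j assume "i < dim_row A" "j < dim_col A"
  then show "A\<^sup>T $$ (i, j) = A $$ (i, j)"
    using assms(3)[of "unit_vec n j" "unit_vec n i"] entry[of j i] entry[of i j] assms(1,2) by simp
qed (use assms in auto)

lemma pos_def_dest:
  assumes "pos_def n P"
  shows "P\<^sup>T = P" "dim_row P = n" "dim_col P = n" "\<And>v. dim_vec v = n \<Longrightarrow> 0 \<le> v \<bullet> (P *\<^sub>v v)"
proof -
  show "P\<^sup>T = P" and P: "dim_row P = n" "dim_col P = n"
    using assms unfolding pos_def_def by blast+
  fix v :: "real vec" assume v: "dim_vec v = n"
  show "0 \<le> v \<bullet> (P *\<^sub>v v)"
  proof (cases "v = 0\<^sub>v n")
    case True
    then have "v \<bullet> (P *\<^sub>v v) = 0"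
      using P by (simp add: sp_sum[of "0\<^sub>v n"])
    then show ?thesis by simp
  next
    case False
    then have "0 < v \<bullet> (P *\<^sub>v v)"
      using assms v unfolding pos_def_def by (blast intro: carrier_vecI)
    then show ?thesis by simp
  qed
qed

lemma pos_def_smult:
  assumes "pos_def n P" "k > 0"
  shows "pos_def n (k \<cdot>\<^sub>m P)"
proof -
  have "(k \<cdot>\<^sub>m P)\<^sup>T = k \<cdot>\<^sub>m P"
    using assms unfolding pos_def_def by (intro sym_smult) blast
  moreover have "0 < v \<bullet> ((k \<cdot>\<^sub>m P) *\<^sub>v v)" if "v \<in> carrier_vec n" "v \<noteq> 0\<^sub>v n" for v
    using assms that pos_def_dest(2,3)[OF assms(1)] unfolding pos_def_def by (simp add: smult_mv)
  ultimately show ?thesis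
    using assms unfolding pos_def_def by simp
qed

section \<open>The quadratic form of the delay inequality\<close>

text \<open>The quadratic form of the delay inequality, with \<open>f\<close> in place of the right-hand side
  \<open>(A - L C) x - L C y\<close> of the dynamics.  Keeping \<open>f\<close> as an argument makes it possible to use the same
  expression for perturbed dynamics and for the cascade of all subpredictors.  The terms in \<open>S\<close> are
  collected into a square of \<open>x + y\<close>, so that \<open>e\<close> enters only through nonpositive terms.\<close>

definition dform :: "real \<Rightarrow> real \<Rightarrow> real \<Rightarrow> real mat \<Rightarrow> real mat \<Rightarrow> real mat \<Rightarrow>
    real vec \<Rightarrow> real vec \<Rightarrow> real vec \<Rightarrow> real" where
  "dform \<delta> e \<tau> P S R x y f =
     2 * (x \<bullet> (P *\<^sub>v f)) + 2 * \<delta> * (x \<bullet> (P *\<^sub>v x)) + x \<bullet> (S *\<^sub>v x)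
     - e * ((x + y) \<bullet> (S *\<^sub>v (x + y))) - e * (y \<bullet> (R *\<^sub>v y)) + \<tau>\<^sup>2 * (f \<bullet> (R *\<^sub>v f))"

lemma dform_mono:
  assumes "e \<le> e'" "\<tau>'\<^sup>2 \<le> \<tau>\<^sup>2" "0 \<le> (x + y) \<bullet> (S *\<^sub>v (x + y))" "0 \<le> y \<bullet> (R *\<^sub>v y)" "0 \<le> f \<bullet> (R *\<^sub>v f)"
  shows "dform \<delta> e' \<tau>' P S R x y f \<le> dform \<delta> e \<tau> P S R x y f"
  using mult_right_mono[OF assms(1,3)] mult_right_mono[OF assms(1,4)] mult_right_mono[OF assms(2,5)]
  by (simp add: dform_def)

lemma delay_LMI_form:
  fixes A L C P S R :: "real mat"
  assumes A: "dim_row A = n" "dim_col A = n" and L: "dim_row L = n" "dim_col L = 1"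
    and C: "dim_row C = 1" "dim_col C = n"
    and P: "P\<^sup>T = P" "dim_row P = n" "dim_col P = n"
    and S: "S\<^sup>T = S" "dim_row S = n" "dim_col S = n"
    and R: "R\<^sup>T = R" "dim_row R = n" "dim_col R = n"
    and x: "dim_vec x = n" and y: "dim_vec y = n"
  shows "(x @\<^sub>v y) \<bullet> (delay_LMI \<delta> h A L C P S R *\<^sub>v (x @\<^sub>v y))
    = dform \<delta> (exp (- 2 * \<delta> * h)) h P S R x y ((A - L * C) *\<^sub>v x - (L * C) *\<^sub>v y)"
proof -
  define D where "D = A - L * C"
  define E where "E = L * C"
  define e where "e = exp (- 2 * \<delta> * h)"
  define f where "f = D *\<^sub>v x - E *\<^sub>v y"
  have D: "dim_row D = n" "dim_col D = n" and E: "dim_row E = n" "dim_col E = n"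
    and f: "dim_vec f = n"
    using A L C by (simp_all add: D_def E_def f_def)
  have ET: "C\<^sup>T * L\<^sup>T = E\<^sup>T"
    unfolding E_def by (rule transpose_mult[symmetric, of _ n 1 _ n]) (use L C in auto)
  have PE: "P * L * C = P * E"
    unfolding E_def by (rule assoc_mult_mat[of _ n n _ 1 _ n]) (use L C P in auto)
  have AE: "A - E = D"
    by (simp only: D_def E_def)
  define \<phi> where "\<phi> = P * D + D\<^sup>T * P + (2 * \<delta>) \<cdot>\<^sub>m P + (1 - e) \<cdot>\<^sub>m S"
  define X where "X = - (P * E) - e \<cdot>\<^sub>m S"
  define T where "T = D\<^sup>T @\<^sub>r (- E\<^sup>T)"
  define U where "U = D @\<^sub>c (- E)"
  have LMI: "delay_LMI \<delta> h A L C P S R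
      = four_block_mat \<phi> X (X\<^sup>T) (- (e \<cdot>\<^sub>m (S + R))) + h\<^sup>2 \<cdot>\<^sub>m (T * R * U)"
    by (simp only: delay_LMI_def Let_def ET PE AE \<phi>_def X_def T_def U_def flip: E_def e_def)
  have dims: "dim_row \<phi> = n" "dim_col \<phi> = n" "dim_row X = n" "dim_col X = n"
    "dim_row T = n + n" "dim_col T = n" "dim_row U = n" "dim_col U = n + n"
    using D E P S by (simp_all add: \<phi>_def X_def T_def U_def)
  have Uv: "U *\<^sub>v (x @\<^sub>v y) = f"
    unfolding U_def f_def using D E x y
    by (subst append_cols_mv) (auto simp: mv_simps intro!: eq_vecI)
  have Tv: "T *\<^sub>v (R *\<^sub>v f) = (D\<^sup>T *\<^sub>v (R *\<^sub>v f)) @\<^sub>v (- (E\<^sup>T *\<^sub>v (R *\<^sub>v f)))"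
    unfolding T_def using D E R f
    by (subst append_rows_mv) (simp_all add: mv_simps)
  have "(x @\<^sub>v y) \<bullet> (T *\<^sub>v (R *\<^sub>v f)) = (R *\<^sub>v f) \<bullet> (D *\<^sub>v x) - (R *\<^sub>v f) \<bullet> (E *\<^sub>v y)"
    unfolding Tv using D E R f x y by (simp add: sp_append sp_simps sp_transpose)
  also have "\<dots> = f \<bullet> (R *\<^sub>v f)"
    unfolding f_def using D E R x y by (subst (3) sp_comm) (simp_all add: sp_simps)
  finally have quad: "(x @\<^sub>v y) \<bullet> (T *\<^sub>v (R *\<^sub>v f)) = f \<bullet> (R *\<^sub>v f)" .
  have "(x @\<^sub>v y) \<bullet> (delay_LMI \<delta> h A L C P S R *\<^sub>v (x @\<^sub>v y))
      = x \<bullet> (\<phi> *\<^sub>v x) + x \<bullet> (X *\<^sub>v y) + (y \<bullet> (X\<^sup>T *\<^sub>v x) - e * (y \<bullet> (S *\<^sub>v y) + y \<bullet> (R *\<^sub>v y)))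
        + h\<^sup>2 * (f \<bullet> (R *\<^sub>v f))"
    unfolding LMI using dims R S x y f quad Uv
    by (simp add: add_mv smult_mv mult_mv four_block_mv sp_append sp_simps uminus_mv)
  moreover have "x \<bullet> (\<phi> *\<^sub>v x) = x \<bullet> (P *\<^sub>v (D *\<^sub>v x)) + (P *\<^sub>v x) \<bullet> (D *\<^sub>v x)
      + 2 * \<delta> * (x \<bullet> (P *\<^sub>v x)) + (1 - e) * (x \<bullet> (S *\<^sub>v x))"
    unfolding \<phi>_def using D P S x by (simp add: mv_simps sp_simps sp_transpose)
  moreover have "(P *\<^sub>v x) \<bullet> (D *\<^sub>v x) = x \<bullet> (P *\<^sub>v (D *\<^sub>v x))"
    using sp_sym[OF P(1), of "D *\<^sub>v x" x] sp_comm[of "P *\<^sub>v x" "D *\<^sub>v x"] D P x by simp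
  moreover have "y \<bullet> (X\<^sup>T *\<^sub>v x) = x \<bullet> (X *\<^sub>v y)"
    using dims x y by (intro sp_transpose) simp_all
  moreover have "x \<bullet> (X *\<^sub>v y) = - (x \<bullet> (P *\<^sub>v (E *\<^sub>v y))) - e * (x \<bullet> (S *\<^sub>v y))"
    unfolding X_def using E P S x y by (simp add: mv_simps sp_simps)
  moreover have "x \<bullet> (P *\<^sub>v f) = x \<bullet> (P *\<^sub>v (D *\<^sub>v x)) - x \<bullet> (P *\<^sub>v (E *\<^sub>v y))"
    unfolding f_def using D E P x y by (simp add: mv_simps sp_simps)
  moreover have "(x + y) \<bullet> (S *\<^sub>v (x + y)) = x \<bullet> (S *\<^sub>v x) + 2 * (x \<bullet> (S *\<^sub>v y)) + y \<bullet> (S *\<^sub>v y)"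
    using S x y sp_sym[OF S(1), of x y] by (simp add: mv_simps sp_simps)
  ultimately show ?thesis
    unfolding dform_def E_def[symmetric] e_def[symmetric] AE f_def[symmetric]
    by (simp add: algebra_simps)
qed

text \<open>Half of the decay rate suffices to absorb a perturbation \<open>p\<close> of the dynamics, up to a multiple of
  \<open>\<bar>p\<bar>\<^sup>2\<close>.\<close>

lemma dform_perturb:
  fixes D E P S R :: "real mat"
  assumes D: "dim_row D = n" "dim_col D = n" and E: "dim_row E = n" "dim_col E = n"
    and P: "dim_row P = n" "dim_col P = n"
    and R: "R\<^sup>T = R" "dim_row R = n" "dim_col R = n"
    and \<kappa>: "\<kappa> > 0"
    and neg: "\<And>x y. dim_vec x = n \<Longrightarrow> dim_vec y = n \<Longrightarrow>
      dform \<delta> e \<tau> P S R x y (D *\<^sub>v x - E *\<^sub>v y) \<le> - \<kappa> * (nsq x + nsq y)"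
  obtains C where "C \<ge> 0"
    "\<And>x y p. dim_vec x = n \<Longrightarrow> dim_vec y = n \<Longrightarrow> dim_vec p = n \<Longrightarrow>
      dform \<delta> e \<tau> P S R x y (D *\<^sub>v x - E *\<^sub>v y + p) \<le> - (\<kappa> / 2) * (nsq x + nsq y) + C * nsq p"
proof -
  define m where "m = frob D + frob E + 1"
  define w where "w = \<tau>\<^sup>2 + 1"
  have w: "w \<ge> 1" "\<tau>\<^sup>2 \<le> w" by (simp_all add: w_def)
  \<comment> \<open>the weight in Young's inequality for which the term \<open>2 \<tau>\<^sup>2 f \<bullet> R p\<close> costs at most \<open>\<kappa> / 4\<close>\<close>
  define t where "t = \<kappa> / (8 * w * m)"
  have m: "m \<ge> 1" "frob D \<le> m" "frob E \<le> m" by (simp_all add: m_def)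
  have t: "t > 0" using \<kappa> m w by (simp add: t_def)
  define C where "C = 4 / \<kappa> * frob P + \<tau>\<^sup>2 * (frob R / t + (1 + frob R) / 2)"
  show thesis
  proof (rule that[of C])
    show "C \<ge> 0" using \<kappa> t by (simp add: C_def)
    fix x y p :: "real vec" assume x: "dim_vec x = n" and y: "dim_vec y = n" and p: "dim_vec p = n"
    define f where "f = D *\<^sub>v x - E *\<^sub>v y"
    have f: "dim_vec f = n" using E by (simp add: f_def)
    have "dform \<delta> e \<tau> P S R x y (f + p) = dform \<delta> e \<tau> P S R x y f
        + 2 * (x \<bullet> (P *\<^sub>v p)) + \<tau>\<^sup>2 * (2 * (f \<bullet> (R *\<^sub>v p)) + p \<bullet> (R *\<^sub>v p))"
      using sp_sym[OF R(1), of f p] x y f p P R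
      by (simp add: dform_def mv_simps sp_simps algebra_simps)
    moreover have "2 * (x \<bullet> (P *\<^sub>v p)) \<le> \<kappa> / 4 * nsq x + 4 / \<kappa> * frob P * nsq p"
    proof -
      have "2 * (x \<bullet> (P *\<^sub>v p)) \<le> \<kappa> / 4 * nsq x + nsq (P *\<^sub>v p) / (\<kappa> / 4)"
        using x P \<kappa> by (intro young) auto
      also have "nsq (P *\<^sub>v p) / (\<kappa> / 4) \<le> (frob P * nsq p) / (\<kappa> / 4)"
        using \<kappa> p P by (intro divide_right_mono nsq_mv_le) auto
      finally show ?thesis by simp
    qed
    moreover have "2 * (f \<bullet> (R *\<^sub>v p)) \<le> t * (2 * m * (nsq x + nsq y)) + frob R / t * nsq p"
    proof -
      have "2 * (f \<bullet> (R *\<^sub>v p)) \<le> t * nsq f + nsq (R *\<^sub>v p) / t"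
        using f R t by (intro young) auto
      also have "nsq (R *\<^sub>v p) / t \<le> (frob R * nsq p) / t"
        using t p R by (intro divide_right_mono nsq_mv_le) auto
      also have "nsq f \<le> 2 * nsq (D *\<^sub>v x) + 2 * nsq (E *\<^sub>v y)"
        unfolding f_def using D E by (intro nsq_minus_le) simp
      also have "\<dots> \<le> 2 * (m * nsq x) + 2 * (m * nsq y)"
        using nsq_mv_le[of x D] nsq_mv_le[of y E] x y D E
          mult_right_mono[OF m(2) nsq_ge_0[of x]] mult_right_mono[OF m(3) nsq_ge_0[of y]] by simp
      also have "\<dots> = 2 * m * (nsq x + nsq y)" by (simp add: algebra_simps)
      finally show ?thesis using t by (simp add: mult_left_mono)
    qed
    moreover have "p \<bullet> (R *\<^sub>v p) \<le> (1 + frob R) / 2 * nsq p"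
      using young[of p "R *\<^sub>v p" 1] nsq_mv_le[of p R] p R by (simp add: algebra_simps)
    ultimately have "dform \<delta> e \<tau> P S R x y (f + p) \<le> dform \<delta> e \<tau> P S R x y f
        + (\<kappa> / 4 * nsq x + 4 / \<kappa> * frob P * nsq p)
        + \<tau>\<^sup>2 * ((t * (2 * m * (nsq x + nsq y)) + frob R / t * nsq p) + (1 + frob R) / 2 * nsq p)"
      by (simp only:) (intro add_mono mult_left_mono order_refl; simp)
    also have "\<dots> = dform \<delta> e \<tau> P S R x y f + \<kappa> / 4 * nsq x
        + \<tau>\<^sup>2 * (t * (2 * m)) * (nsq x + nsq y) + C * nsq p"
      by (simp add: C_def algebra_simps)
    also have "\<dots> \<le> - \<kappa> * (nsq x + nsq y) + \<kappa> / 4 * (nsq x + nsq y) + \<kappa> / 4 * (nsq x + nsq y) + C * nsq p"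
    proof (intro add_mono mult_right_mono order_refl)
      show "dform \<delta> e \<tau> P S R x y f \<le> - \<kappa> * (nsq x + nsq y)"
        unfolding f_def using x y by (rule neg)
      have "\<tau>\<^sup>2 * (t * (2 * m)) = \<tau>\<^sup>2 / w * (\<kappa> / 4)"
        using m w by (simp add: t_def field_simps)
      also have "\<dots> \<le> 1 * (\<kappa> / 4)"
        using \<kappa> w by (intro mult_right_mono) (simp_all add: divide_le_eq_1)
      finally show "\<tau>\<^sup>2 * (t * (2 * m)) \<le> \<kappa> / 4" by simp
      show "\<kappa> / 4 * nsq x \<le> \<kappa> / 4 * (nsq x + nsq y)"
        using \<kappa> by (intro mult_left_mono) auto
    qed simp_all
    finally show "dform \<delta> e \<tau> P S R x y (D *\<^sub>v x - E *\<^sub>v y + p) \<le> - (\<kappa> / 2) * (nsq x + nsq y) + C * nsq p"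
      by (simp add: f_def algebra_simps add_divide_distrib)
  qed
qed

section \<open>Block vectors and Kronecker products\<close>

text \<open>The \<open>i\<close>-th block, counted from 0, of a vector made of blocks of length \<open>n\<close>.\<close>

definition blk :: "nat \<Rightarrow> real vec \<Rightarrow> nat \<Rightarrow> real vec" where
  "blk n v i = Matrix.vec n (\<lambda>k. v $ (i * n + k))"

lemma dim_blk [simp]: "dim_vec (blk n v i) = n"
  by (simp add: blk_def)

lemma blk_index [simp]: "k < n \<Longrightarrow> blk n v i $ k = v $ (i * n + k)"
  by (simp add: blk_def)

lemma blk_index_less: "i * n + k < M * n" if "i < M" "k < n" for i k M n :: nat
proof -
  have "i * n + k < Suc i * n" using that by simp
  also have "\<dots> \<le> M * n" using that by (intro mult_right_mono) simp_all
  finally show ?thesis .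
qed

lemma blk_add: "i < M \<Longrightarrow> dim_vec w = M * n \<Longrightarrow> blk n (v + w) i = blk n v i + blk n w i"
  by (intro eq_vecI) (simp_all add: blk_index_less)

lemma blk_uminus: "i < M \<Longrightarrow> dim_vec v = M * n \<Longrightarrow> blk n (- v) i = - blk n v i"
  by (intro eq_vecI) (simp_all add: blk_index_less)

lemma sum_blocks: "(\<Sum>l<M * n. g l) = (\<Sum>i<M. \<Sum>k<n. g (i * n + k))" for g :: "nat \<Rightarrow> real"
proof -
  have "sum g {m * n..<m * n + n} = (\<Sum>k<n. g (m * n + k))" for m
    using sum.shift_bounds_nat_ivl[of g 0 "m * n" n] by (simp add: atLeast0LessThan add.commute)
  then show ?thesis
    by (simp flip: sum.nat_group)
qed

lemma sp_blk:
  assumes "dim_vec w = M * n"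
  shows "v \<bullet> w = (\<Sum>i<M. blk n v i \<bullet> blk n w i)"
  by (simp add: sp_sum assms sum_blocks)

lemma nsq_blk: "dim_vec v = M * n \<Longrightarrow> nsq v = (\<Sum>i<M. nsq (blk n v i))"
  by (simp add: nsq_def sp_blk)

lemma blk_kron:
  assumes X: "dim_row X = M" "dim_col X = M" and Y: "dim_row Y = n" "dim_col Y = n"
    and v: "dim_vec v = M * n" and i: "i < M" and k: "k < n"
  shows "blk n ((X \<otimes>\<^sub>K Y) *\<^sub>v v) i $ k = (\<Sum>j<M. X $$ (i, j) * (Y *\<^sub>v blk n v j) $ k)"
proof -
  have "((X \<otimes>\<^sub>K Y) *\<^sub>v v) $ (i * n + k) = (\<Sum>l<M * n. (X \<otimes>\<^sub>K Y) $$ (i * n + k, l) * v $ l)"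
    using X Y v blk_index_less[OF i k] by (subst mv_index) simp_all
  also have "\<dots> = (\<Sum>l<M * n. X $$ (i, l div n) * Y $$ (k, l mod n) * v $ l)"
    using X Y k blk_index_less[OF i k] by (simp add: kron_def)
  also have "\<dots> = (\<Sum>j<M. \<Sum>l<n. X $$ (i, j) * Y $$ (k, l) * v $ (j * n + l))"
    by (simp add: sum_blocks)
  also have "\<dots> = (\<Sum>j<M. X $$ (i, j) * (Y *\<^sub>v blk n v j) $ k)"
    using Y k by (simp add: mv_index sum_distrib_left mult.assoc del: index_mult_mat_vec)
  finally show ?thesis
    using k by simp
qed

lemma blk_diag_kron:
  assumes Y: "dim_row Y = n" "dim_col Y = n" and v: "dim_vec v = M * n" and i: "i < M"
  shows "blk n ((mat_diag M s \<otimes>\<^sub>K Y) *\<^sub>v v) i = s i \<cdot>\<^sub>v (Y *\<^sub>v blk n v i)"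
proof (rule eq_vecI)
  fix k assume "k < dim_vec (s i \<cdot>\<^sub>v (Y *\<^sub>v blk n v i))"
  then have k: "k < n" using Y by simp
  have "blk n ((mat_diag M s \<otimes>\<^sub>K Y) *\<^sub>v v) i $ k
      = (\<Sum>j<M. mat_diag M s $$ (i, j) * (Y *\<^sub>v blk n v j) $ k)"
    using Y v i k by (intro blk_kron) (simp_all add: mat_diag_def)
  also have "\<dots> = (\<Sum>j<M. if j = i then s i * (Y *\<^sub>v blk n v i) $ k else 0)"
    using i by (intro sum.cong) (auto simp: mat_diag_def)
  finally show "blk n ((mat_diag M s \<otimes>\<^sub>K Y) *\<^sub>v v) i $ k = (s i \<cdot>\<^sub>v (Y *\<^sub>v blk n v i)) $ k"
    using i k Y by simp
qed (use Y in simp)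

lemma blk_one_kron:
  assumes Y: "dim_row Y = n" "dim_col Y = n" and v: "dim_vec v = M * n" and i: "i < M"
  shows "blk n ((1\<^sub>m M \<otimes>\<^sub>K Y) *\<^sub>v v) i = Y *\<^sub>v blk n v i"
proof -
  have "(1\<^sub>m M :: real mat) = mat_diag M (\<lambda>_. 1)"
    by (intro eq_matI) (auto simp: mat_diag_def)
  then show ?thesis
    using blk_diag_kron[OF Y v i, of "\<lambda>_. 1"] by simp
qed

text \<open>The nilpotent Jordan block shifts the blocks by one position.\<close>

lemma blk_jordan_kron:
  assumes Y: "dim_row Y = n" "dim_col Y = n" and v: "dim_vec v = M * n" and i: "i < M"
  shows "blk n ((jordan_block M 0 \<otimes>\<^sub>K Y) *\<^sub>v v) i
    = (if Suc i < M then Y *\<^sub>v blk n v (Suc i) else 0\<^sub>v n)" (is "_ = ?r")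
proof (rule eq_vecI)
  fix k assume "k < dim_vec ?r"
  then have k: "k < n" using Y by (simp split: if_splits)
  have "blk n ((jordan_block M 0 \<otimes>\<^sub>K Y) *\<^sub>v v) i $ k
      = (\<Sum>j<M. jordan_block M 0 $$ (i, j) * (Y *\<^sub>v blk n v j) $ k)"
    using Y v i k by (intro blk_kron) (simp_all add: jordan_block_def)
  also have "\<dots> = (\<Sum>j<M. if j = Suc i then (Y *\<^sub>v blk n v (Suc i)) $ k else 0)"
    using i by (intro sum.cong) (auto simp: jordan_block_def)
  finally show "blk n ((jordan_block M 0 \<otimes>\<^sub>K Y) *\<^sub>v v) i $ k = ?r $ k"
    using i k Y by simp
qed (use Y in simp)

lemma sp_diag_kron:
  assumes "dim_row Y = n" "dim_col Y = n" "dim_vec v = M * n"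
  shows "w \<bullet> ((mat_diag M s \<otimes>\<^sub>K Y) *\<^sub>v v) = (\<Sum>i<M. s i * (blk n w i \<bullet> (Y *\<^sub>v blk n v i)))"
proof -
  have "w \<bullet> ((mat_diag M s \<otimes>\<^sub>K Y) *\<^sub>v v)
      = (\<Sum>i<M. blk n w i \<bullet> blk n ((mat_diag M s \<otimes>\<^sub>K Y) *\<^sub>v v) i)"
    using assms by (intro sp_blk) (simp add: mat_diag_def)
  also have "\<dots> = (\<Sum>i<M. s i * (blk n w i \<bullet> (Y *\<^sub>v blk n v i)))"
    using assms by (intro sum.cong) (simp_all add: blk_diag_kron)
  finally show ?thesis .
qed

lemma dim_mat_diag [simp]: "dim_row (mat_diag n f) = n" "dim_col (mat_diag n f) = n"
  by (simp_all add: mat_diag_def)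

lemma pos_def_diag_kron:
  assumes P: "pos_def n P" and s: "\<And>i. i < M \<Longrightarrow> s i > 0"
  shows "pos_def (M * n) (mat_diag M s \<otimes>\<^sub>K P)"
proof -
  note sym = pos_def_dest(1)[OF P] and d = pos_def_dest(2,3)[OF P] and nonneg = pos_def_dest(4)[OF P]
  have pos: "\<And>v. dim_vec v = n \<Longrightarrow> v \<noteq> 0\<^sub>v n \<Longrightarrow> 0 < v \<bullet> (P *\<^sub>v v)"
    using P unfolding pos_def_def by (blast intro: carrier_vecI)
  have "(mat_diag M s \<otimes>\<^sub>K P)\<^sup>T = mat_diag M s \<otimes>\<^sub>K P"
  proof (rule sym_if_bilinear_sym)
    fix x y :: "real vec" assume "dim_vec x = M * n" "dim_vec y = M * n"
    then show "x \<bullet> ((mat_diag M s \<otimes>\<^sub>K P) *\<^sub>v y) = y \<bullet> ((mat_diag M s \<otimes>\<^sub>K P) *\<^sub>v x)"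
      using sp_sym[OF sym] d by (simp add: sp_diag_kron)
  qed (simp_all add: d)
  moreover have "0 < v \<bullet> ((mat_diag M s \<otimes>\<^sub>K P) *\<^sub>v v)" if v: "dim_vec v = M * n" and nz: "v \<noteq> 0\<^sub>v (M * n)" for v
  proof -
    have "nsq v \<noteq> 0"
      using v nz nsq_eq_0_iff by metis
    then obtain i where i: "i < M" "nsq (blk n v i) \<noteq> 0"
      unfolding nsq_blk[OF v] by (metis lessThan_iff sum.neutral)
    then have "blk n v i \<noteq> 0\<^sub>v n"
      by auto
    then have "0 < s i * (blk n v i \<bullet> (P *\<^sub>v blk n v i))"
      using s[OF i(1)] by (simp add: pos)
    moreover have "0 \<le> s j * (blk n v j \<bullet> (P *\<^sub>v blk n v j))" if "j < M" for j
      using s[OF that] nonneg by (simp add: less_imp_le)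
    ultimately show ?thesis
      using i(1) by (subst sp_diag_kron[OF d v]) (intro sum_pos2[of _ i]; simp)
  qed
  ultimately show ?thesis
    unfolding pos_def_def using d by (auto intro!: carrier_matI dest: carrier_vecD)
qed

lemma dform_diag_kron:
  assumes P: "dim_row P = n" "dim_col P = n" and S: "dim_row S = n" "dim_col S = n"
    and R: "dim_row R = n" "dim_col R = n"
    and z: "dim_vec z = M * n" and w: "dim_vec w = M * n" and f: "dim_vec f = M * n"
  shows "dform \<delta> e \<tau> (mat_diag M s \<otimes>\<^sub>K P) (mat_diag M s \<otimes>\<^sub>K S) (mat_diag M s \<otimes>\<^sub>K R) z w f
    = (\<Sum>i<M. s i * dform \<delta> e \<tau> P S R (blk n z i) (blk n w i) (blk n f i))"
proof -
  have add: "blk n (z + w) i = blk n z i + blk n w i" if "i < M" for i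
    using that w by (rule blk_add)
  have "dform \<delta> e \<tau> (mat_diag M s \<otimes>\<^sub>K P) (mat_diag M s \<otimes>\<^sub>K S) (mat_diag M s \<otimes>\<^sub>K R) z w f
    = (\<Sum>i<M. 2 * (s i * (blk n z i \<bullet> (P *\<^sub>v blk n f i)))
        + 2 * \<delta> * (s i * (blk n z i \<bullet> (P *\<^sub>v blk n z i)))
        + s i * (blk n z i \<bullet> (S *\<^sub>v blk n z i))
        - e * (s i * (blk n (z + w) i \<bullet> (S *\<^sub>v blk n (z + w) i)))
        - e * (s i * (blk n w i \<bullet> (R *\<^sub>v blk n w i)))
        + \<tau>\<^sup>2 * (s i * (blk n f i \<bullet> (R *\<^sub>v blk n f i))))"
    using assms
    by (simp add: dform_def sp_diag_kron sum.distrib sum_subtractf sum_distrib_left)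
  also have "\<dots> = (\<Sum>i<M. s i * dform \<delta> e \<tau> P S R (blk n z i) (blk n w i) (blk n f i))"
    by (intro sum.cong refl) (simp add: dform_def add algebra_simps)
  finally show ?thesis .
qed

section \<open>The cascade of subpredictors\<close>

lemma dim_F_e [simp]: "dim_row (F_e M A L C) = M * dim_row L" "dim_col (F_e M A L C) = M * dim_col C"
  by (simp_all add: F_e_def jordan_block_def)

lemma dim_G_e [simp]: "dim_row (G_e M L C) = M * dim_row L" "dim_col (G_e M L C) = M * dim_col C"
  by (simp_all add: G_e_def jordan_block_def)

lemma dim_row_L_e [simp]: "M > 0 \<Longrightarrow> dim_row (L_e M L) = M * dim_row L"
proof -
  assume "M > 0"
  then have "M \<noteq> 1 \<Longrightarrow> (M - 2) * dim_row L + (dim_row L + dim_row L) = M * dim_row L"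
    by (cases M; cases "M - 1") auto
  then show ?thesis
    by (simp add: L_e_def)
qed

lemma dim_col_L_e [simp]: "dim_col L = 1 \<Longrightarrow> dim_col (L_e M L) = 1"
  by (simp add: L_e_def)

lemma blk_L_e:
  assumes L: "dim_row L = n" "dim_col L = 1" and u: "dim_vec u = 1" and i: "i < M"
  shows "blk n (L_e M L *\<^sub>v u) i
    = (if Suc i = M then - (L *\<^sub>v u) else if Suc (Suc i) = M then L *\<^sub>v u else 0\<^sub>v n)"
proof (cases "M = 1")
  case True
  then show ?thesis
    using L u i by (intro eq_vecI) (simp_all add: L_e_def uminus_mv)
next
  case False
  then obtain m where m: "M = Suc (Suc m)"
    using i by (metis One_nat_def less_nat_zero_code not0_implies_Suc)
  have *: "L_e M L *\<^sub>v u = 0\<^sub>v (m * n) @\<^sub>v (L *\<^sub>v u @\<^sub>v - (L *\<^sub>v u))"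
    using L u m by (simp add: L_e_def append_rows_mv uminus_mv zero_mv)
  show ?thesis
  proof (rule eq_vecI)
    fix k assume "k < dim_vec (if Suc i = M then - (L *\<^sub>v u) else if Suc (Suc i) = M then L *\<^sub>v u else 0\<^sub>v n)"
    then have k: "k < n" using L by (simp split: if_splits)
    consider "i < m" | "i = m" | "i = Suc m" using i m by linarith
    then show "blk n (L_e M L *\<^sub>v u) i $ k = (if Suc i = M then - (L *\<^sub>v u)
        else if Suc (Suc i) = M then L *\<^sub>v u else 0\<^sub>v n) $ k"
    proof cases
      case 1
      then have "i * n + k < m * n" using k by (rule blk_index_less)
      then show ?thesis using 1 k m L unfolding * by (simp del: index_mult_mat_vec)
    next
      case 2
      then show ?thesis using k m L unfolding * by (simp del: index_mult_mat_vec)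
    next
      case 3
      then show ?thesis using k m L unfolding * by (simp del: index_mult_mat_vec)
    qed
  qed (use L in simp)
qed

text \<open>Each subpredictor satisfies the single-delay dynamics, perturbed by the next subpredictor and by
  the input \<open>u\<close>.\<close>

lemma blk_cascade:
  fixes A L C :: "real mat"
  assumes A: "dim_row A = n" "dim_col A = n" and L: "dim_row L = n" "dim_col L = 1"
    and C: "dim_row C = 1" "dim_col C = n"
    and z: "dim_vec z = M * n" and w: "dim_vec w = M * n" and u: "dim_vec u = 1" and i: "i < M"
  obtains p where "dim_vec p = n"
    "blk n (F_e M A L C *\<^sub>v z + G_e M L C *\<^sub>v w + L_e M L *\<^sub>v u) i
      = (A - L * C) *\<^sub>v blk n z i - (L * C) *\<^sub>v blk n w i + p"
    "nsq p \<le> 4 * frob (L * C) * (if Suc i < M then nsq (blk n z (Suc i)) + nsq (blk n w (Suc i)) else 0)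
       + 2 * frob L * nsq u"
proof -
  define E where "E = L * C"
  define D where "D = A - E"
  have E: "dim_row E = n" "dim_col E = n" and D: "dim_row D = n" "dim_col D = n"
    using A L C by (simp_all add: E_def D_def)
  have J: "dim_row (jordan_block M (0::real)) = M" "dim_col (jordan_block M (0::real)) = M"
    by (simp_all add: jordan_block_def)
  define g where "g = (if Suc i < M then E *\<^sub>v blk n z (Suc i) + E *\<^sub>v blk n w (Suc i) else 0\<^sub>v n)"
  define l where "l = blk n (L_e M L *\<^sub>v u) i"
  have g: "dim_vec g = n" and l: "dim_vec l = n"
    using E by (simp_all add: g_def l_def)
  have F: "F_e M A L C *\<^sub>v z = (1\<^sub>m M \<otimes>\<^sub>K D) *\<^sub>v z + (jordan_block M 0 \<otimes>\<^sub>K E) *\<^sub>v z"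
    unfolding F_e_def E_def[symmetric] D_def[symmetric] using D E z J by (simp add: add_mv)
  have G: "G_e M L C *\<^sub>v w = - ((1\<^sub>m M \<otimes>\<^sub>K E) *\<^sub>v w) + (jordan_block M 0 \<otimes>\<^sub>K E) *\<^sub>v w"
    unfolding G_e_def E_def[symmetric] D_def[symmetric] using D E w J by (simp add: add_mv uminus_mv)
  have Ldim: "dim_row (L_e M L) = M * n"
    using L i by simp
  have "blk n (F_e M A L C *\<^sub>v z + G_e M L C *\<^sub>v w + L_e M L *\<^sub>v u) i
     = D *\<^sub>v blk n z i + (if Suc i < M then E *\<^sub>v blk n z (Suc i) else 0\<^sub>v n)
       + (- (E *\<^sub>v blk n w i) + (if Suc i < M then E *\<^sub>v blk n w (Suc i) else 0\<^sub>v n)) + l"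
    unfolding F G l_def using D E J z w i Ldim
    by (simp add: blk_add[of _ M] blk_uminus[of _ M] blk_one_kron blk_jordan_kron)
  also have "\<dots> = D *\<^sub>v blk n z i - E *\<^sub>v blk n w i + (g + l)"
    unfolding g_def using D E l by (intro eq_vecI) (simp_all del: index_mult_mat_vec)
  finally have eq: "blk n (F_e M A L C *\<^sub>v z + G_e M L C *\<^sub>v w + L_e M L *\<^sub>v u) i
     = D *\<^sub>v blk n z i - E *\<^sub>v blk n w i + (g + l)" .
  have "nsq g \<le> 2 * frob E * (if Suc i < M then nsq (blk n z (Suc i)) + nsq (blk n w (Suc i)) else 0)"
  proof (cases "Suc i < M")
    case True
    have "nsq g \<le> 2 * nsq (E *\<^sub>v blk n z (Suc i)) + 2 * nsq (E *\<^sub>v blk n w (Suc i))"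
      using True by (simp add: g_def nsq_add_le)
    also have "\<dots> \<le> 2 * (frob E * nsq (blk n z (Suc i))) + 2 * (frob E * nsq (blk n w (Suc i)))"
      using E by (intro add_mono mult_left_mono nsq_mv_le) auto
    finally show ?thesis using True by (simp add: algebra_simps)
  qed (simp add: g_def)
  moreover have "nsq l \<le> frob L * nsq u"
    using nsq_mv_le[of u L] L u i by (auto simp: l_def blk_L_e)
  moreover have "nsq (g + l) \<le> 2 * nsq g + 2 * nsq l"
    using g l by (intro nsq_add_le) simp
  ultimately have "nsq (g + l) \<le> 4 * frob E
      * (if Suc i < M then nsq (blk n z (Suc i)) + nsq (blk n w (Suc i)) else 0) + 2 * frob L * nsq u"
    by linarith
  with eq show thesis
    using g l by (intro that[of "g + l"]) (simp_all flip: E_def D_def)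
qed

text \<open>The coupling to the next block is dominated by the decay of that block, when its weight is larger
  by a sufficient factor \<open>\<sigma>\<close>.\<close>

lemma dform_cascade:
  fixes A L C P S R :: "real mat"
  assumes A: "dim_row A = n" "dim_col A = n" and L: "dim_row L = n" "dim_col L = 1"
    and C: "dim_row C = 1" "dim_col C = n"
    and P: "dim_row P = n" "dim_col P = n" and S: "dim_row S = n" "dim_col S = n"
    and R: "R\<^sup>T = R" "dim_row R = n" "dim_col R = n"
    and M: "M > 0" and \<kappa>: "\<kappa> > 0"
    and neg: "\<And>x y. dim_vec x = n \<Longrightarrow> dim_vec y = n \<Longrightarrow>
      dform \<delta> e \<tau> P S R x y ((A - L * C) *\<^sub>v x - (L * C) *\<^sub>v y) \<le> - \<kappa> * (nsq x + nsq y)"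
  obtains s Cu where "\<And>i. s i > 0" "Cu \<ge> 0"
    "\<And>z w u. dim_vec z = M * n \<Longrightarrow> dim_vec w = M * n \<Longrightarrow> dim_vec u = 1 \<Longrightarrow>
      dform \<delta> e \<tau> (mat_diag M s \<otimes>\<^sub>K P) (mat_diag M s \<otimes>\<^sub>K S) (mat_diag M s \<otimes>\<^sub>K R) z w
        (F_e M A L C *\<^sub>v z + G_e M L C *\<^sub>v w + L_e M L *\<^sub>v u)
      \<le> - (\<kappa> / 4) * (nsq z + nsq w) + Cu * nsq u"
proof -
  define E where "E = L * C"
  define D where "D = A - L * C"
  have E: "dim_row E = n" "dim_col E = n" and D: "dim_row D = n" "dim_col D = n"
    using A L C by (simp_all add: E_def D_def)
  obtain c where c: "c \<ge> 0" "\<And>x y p. dim_vec x = n \<Longrightarrow> dim_vec y = n \<Longrightarrow> dim_vec p = n \<Longrightarrow>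
      dform \<delta> e \<tau> P S R x y (D *\<^sub>v x - E *\<^sub>v y + p) \<le> - (\<kappa> / 2) * (nsq x + nsq y) + c * nsq p"
    using dform_perturb[OF D E P R \<kappa>, of \<delta> e \<tau> S] neg unfolding D_def E_def by blast
  define \<sigma> where "\<sigma> = 1 + 16 * c * frob E / \<kappa>"
  have \<sigma>: "\<sigma> \<ge> 1" using c(1) \<kappa> by (simp add: \<sigma>_def)
  have \<sigma>_large: "c * (4 * frob E) \<le> \<kappa> / 4 * \<sigma>"
    using \<kappa> by (simp add: \<sigma>_def field_simps)
  have s: "\<sigma> ^ i \<ge> 1" for i using \<sigma> by simp
  define Cu where "Cu = (\<Sum>i<M. \<sigma> ^ i * (c * (2 * frob L)))"
  show thesis
  proof (rule that[of "\<lambda>i. \<sigma> ^ i" Cu])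
    show "\<sigma> ^ i > 0" for i using s[of i] by linarith
    show "Cu \<ge> 0" unfolding Cu_def using c(1) \<sigma> by (intro sum_nonneg) simp
    fix z w u :: "real vec"
    assume z: "dim_vec z = M * n" and w: "dim_vec w = M * n" and u: "dim_vec u = 1"
    define a where "a i = nsq (blk n z i) + nsq (blk n w i)" for i
    \<comment> \<open>the decay of block \<open>i + 1\<close> that is spent on its coupling to block \<open>i\<close>\<close>
    define b where "b i = (if Suc i < M then \<sigma> ^ Suc i * a (Suc i) else 0)" for i
    define f where "f = F_e M A L C *\<^sub>v z + G_e M L C *\<^sub>v w + L_e M L *\<^sub>v u"
    have f: "dim_vec f = M * n"
      using A L C M by (simp add: f_def)
    have a: "0 \<le> a i" for i by (simp add: a_def)
    have each: "\<sigma> ^ i * dform \<delta> e \<tau> P S R (blk n z i) (blk n w i) (blk n f i)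
       \<le> - (\<kappa> / 2) * (\<sigma> ^ i * a i) + \<kappa> / 4 * b i + \<sigma> ^ i * (c * (2 * frob L)) * nsq u" if i: "i < M" for i
    proof -
      obtain p where p: "dim_vec p = n" "blk n f i = D *\<^sub>v blk n z i - E *\<^sub>v blk n w i + p"
        "nsq p \<le> 4 * frob E * (if Suc i < M then a (Suc i) else 0) + 2 * frob L * nsq u"
        using blk_cascade[OF A L C z w u i] unfolding f_def D_def E_def a_def by blast
      have "dform \<delta> e \<tau> P S R (blk n z i) (blk n w i) (blk n f i) \<le> - (\<kappa> / 2) * a i + c * nsq p"
        unfolding p(2) a_def using p(1) by (intro c(2)) simp_all
      also have "c * nsq p \<le> c * (4 * frob E * (if Suc i < M then a (Suc i) else 0) + 2 * frob L * nsq u)"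
        using p(3) c(1) by (rule mult_left_mono)
      also have "\<dots> = c * (4 * frob E) * (if Suc i < M then a (Suc i) else 0) + c * (2 * frob L) * nsq u"
        by (simp add: algebra_simps)
      also have "\<dots> \<le> \<kappa> / 4 * \<sigma> * (if Suc i < M then a (Suc i) else 0) + c * (2 * frob L) * nsq u"
        using \<sigma>_large a by (intro add_right_mono mult_right_mono) auto
      finally have "\<sigma> ^ i * dform \<delta> e \<tau> P S R (blk n z i) (blk n w i) (blk n f i)
         \<le> \<sigma> ^ i * (- (\<kappa> / 2) * a i + (\<kappa> / 4 * \<sigma> * (if Suc i < M then a (Suc i) else 0) + c * (2 * frob L) * nsq u))"
        using s[of i] by (intro mult_left_mono) simp_all
      also have "\<dots> = - (\<kappa> / 2) * (\<sigma> ^ i * a i) + \<kappa> / 4 * b i + \<sigma> ^ i * (c * (2 * frob L)) * nsq u"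
        by (simp add: b_def algebra_simps)
      finally show ?thesis .
    qed
    have shift: "(\<Sum>i<M. b i) \<le> (\<Sum>i<M. \<sigma> ^ i * a i)"
    proof (cases M)
      case (Suc m)
      have "(\<Sum>i<M. b i) = (\<Sum>i<m. \<sigma> ^ Suc i * a (Suc i))"
        by (simp add: Suc b_def)
      moreover have "(\<Sum>i<M. \<sigma> ^ i * a i) = a 0 + (\<Sum>i<m. \<sigma> ^ Suc i * a (Suc i))"
        unfolding Suc by (subst sum.lessThan_Suc_shift) simp
      ultimately show ?thesis using a[of 0] by simp
    qed simp
    have "nsq z + nsq w = (\<Sum>i<M. a i)"
      by (simp add: a_def sum.distrib nsq_blk[OF z] nsq_blk[OF w])
    also have "\<dots> \<le> (\<Sum>i<M. \<sigma> ^ i * a i)"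
    proof (rule sum_mono)
      show "a i \<le> \<sigma> ^ i * a i" for i
        using mult_right_mono[OF s[of i] a[of i]] by simp
    qed
    finally have weights: "nsq z + nsq w \<le> (\<Sum>i<M. \<sigma> ^ i * a i)" .
    have "dform \<delta> e \<tau> (mat_diag M ((^) \<sigma>) \<otimes>\<^sub>K P) (mat_diag M ((^) \<sigma>) \<otimes>\<^sub>K S) (mat_diag M ((^) \<sigma>) \<otimes>\<^sub>K R) z w f
      = (\<Sum>i<M. \<sigma> ^ i * dform \<delta> e \<tau> P S R (blk n z i) (blk n w i) (blk n f i))"
      using P S R(2,3) z w f by (rule dform_diag_kron)
    also have "\<dots> \<le> (\<Sum>i<M. - (\<kappa> / 2) * (\<sigma> ^ i * a i) + \<kappa> / 4 * b i + \<sigma> ^ i * (c * (2 * frob L)) * nsq u)"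
      by (intro sum_mono each) simp
    also have "\<dots> = - (\<kappa> / 2) * (\<Sum>i<M. \<sigma> ^ i * a i) + \<kappa> / 4 * (\<Sum>i<M. b i) + Cu * nsq u"
      by (simp add: sum.distrib sum_distrib_left sum_distrib_right Cu_def sum_subtractf sum_negf)
    also have "\<dots> \<le> - (\<kappa> / 4) * (\<Sum>i<M. \<sigma> ^ i * a i) + Cu * nsq u"
    proof -
      have "\<kappa> / 4 * (\<Sum>i<M. b i) \<le> \<kappa> / 4 * (\<Sum>i<M. \<sigma> ^ i * a i)"
        using shift \<kappa> by (intro mult_left_mono) simp_all
      then show ?thesis by linarith
    qed
    also have "\<dots> \<le> - (\<kappa> / 4) * (nsq z + nsq w) + Cu * nsq u"
      using mult_left_mono[OF weights, of "\<kappa> / 4"] \<kappa> by simp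
    finally show "dform \<delta> e \<tau> (mat_diag M ((^) \<sigma>) \<otimes>\<^sub>K P) (mat_diag M ((^) \<sigma>) \<otimes>\<^sub>K S)
        (mat_diag M ((^) \<sigma>) \<otimes>\<^sub>K R) z w (F_e M A L C *\<^sub>v z + G_e M L C *\<^sub>v w + L_e M L *\<^sub>v u)
      \<le> - (\<kappa> / 4) * (nsq z + nsq w) + Cu * nsq u"
      by (simp add: f_def)
  qed
qed

section \<open>The quadratic form of the closed-loop inequality\<close>

text \<open>The symmetric block matrix with the sparsity pattern of the closed-loop inequality, on vectors
  split into parts of dimensions \<open>n\<close>, \<open>m\<close>, \<open>m\<close> and \<open>k\<close>.\<close>

definition block4 :: "nat \<Rightarrow> nat \<Rightarrow> nat \<Rightarrow> real mat \<Rightarrow> real mat \<Rightarrow> real mat \<Rightarrow> real mat \<Rightarrow> real mat \<Rightarrow>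
    real mat \<Rightarrow> real mat \<Rightarrow> real mat" where
  "block4 n m k X11 X12 X22 X23 X24 X33 X44 =
        (X11      @\<^sub>c X12     @\<^sub>c 0\<^sub>m n m  @\<^sub>c 0\<^sub>m n k)
     @\<^sub>r (X12\<^sup>T     @\<^sub>c X22     @\<^sub>c X23      @\<^sub>c X24)
     @\<^sub>r (0\<^sub>m m n   @\<^sub>c X23\<^sup>T   @\<^sub>c X33      @\<^sub>c 0\<^sub>m m k)
     @\<^sub>r (0\<^sub>m k n   @\<^sub>c X24\<^sup>T   @\<^sub>c 0\<^sub>m k m  @\<^sub>c X44)"

context
  fixes n m k :: nat and X11 X12 X22 X23 X24 X33 X44 :: "real mat"
  assumes dims: "dim_row X11 = n" "dim_col X11 = n" "dim_row X12 = n" "dim_col X12 = m"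
    "dim_row X22 = m" "dim_col X22 = m" "dim_row X23 = m" "dim_col X23 = m"
    "dim_row X24 = m" "dim_col X24 = k" "dim_row X33 = m" "dim_col X33 = m"
    "dim_row X44 = k" "dim_col X44 = k"
begin

lemma dim_block4:
  "dim_row (block4 n m k X11 X12 X22 X23 X24 X33 X44) = n + (m + (m + k))"
  "dim_col (block4 n m k X11 X12 X22 X23 X24 X33 X44) = n + (m + (m + k))"
  using dims by (simp_all add: block4_def)

text \<open>The bilinear form is computed for two different vectors: symmetry of the matrix follows by
  exchanging them, and the quadratic form by identifying them.\<close>

lemma block4_bilinear:
  assumes v: "dim_vec x = n" "dim_vec z = m" "dim_vec w = m" "dim_vec u = k"
    and v': "dim_vec x' = n" "dim_vec z' = m" "dim_vec w' = m" "dim_vec u' = k"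
  shows "(x' @\<^sub>v (z' @\<^sub>v (w' @\<^sub>v u'))) \<bullet>
      (block4 n m k X11 X12 X22 X23 X24 X33 X44 *\<^sub>v (x @\<^sub>v (z @\<^sub>v (w @\<^sub>v u))))
    = x' \<bullet> (X11 *\<^sub>v x) + x' \<bullet> (X12 *\<^sub>v z) + x \<bullet> (X12 *\<^sub>v z') + z' \<bullet> (X22 *\<^sub>v z)
      + z' \<bullet> (X23 *\<^sub>v w) + z \<bullet> (X23 *\<^sub>v w') + z' \<bullet> (X24 *\<^sub>v u) + z \<bullet> (X24 *\<^sub>v u')
      + w' \<bullet> (X33 *\<^sub>v w) + u' \<bullet> (X44 *\<^sub>v u)"
  unfolding block4_def using dims v v'
  by (simp add: append_rows_mv append_cols_mv sp_append zero_mv sp_add_right sp_transpose)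

lemma block4_sym:
  assumes "X11\<^sup>T = X11" "X22\<^sup>T = X22" "X33\<^sup>T = X33" "X44\<^sup>T = X44"
  shows "(block4 n m k X11 X12 X22 X23 X24 X33 X44)\<^sup>T = block4 n m k X11 X12 X22 X23 X24 X33 X44"
proof (rule sym_if_bilinear_sym[OF dim_block4])
  fix a b :: "real vec" assume a: "dim_vec a = n + (m + (m + k))" and b: "dim_vec b = n + (m + (m + k))"
  obtain x a1 where a1: "a = x @\<^sub>v a1" "dim_vec x = n" "dim_vec a1 = m + (m + k)"
    using a by (rule append_vec_exhaust)
  obtain z a2 where a2: "a1 = z @\<^sub>v a2" "dim_vec z = m" "dim_vec a2 = m + k"
    using a1(3) by (rule append_vec_exhaust)
  obtain w u where a3: "a2 = w @\<^sub>v u" "dim_vec w = m" "dim_vec u = k"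
    using a2(3) by (rule append_vec_exhaust)
  obtain x' b1 where b1: "b = x' @\<^sub>v b1" "dim_vec x' = n" "dim_vec b1 = m + (m + k)"
    using b by (rule append_vec_exhaust)
  obtain z' b2 where b2: "b1 = z' @\<^sub>v b2" "dim_vec z' = m" "dim_vec b2 = m + k"
    using b1(3) by (rule append_vec_exhaust)
  obtain w' u' where b3: "b2 = w' @\<^sub>v u'" "dim_vec w' = m" "dim_vec u' = k"
    using b2(3) by (rule append_vec_exhaust)
  have "x' \<bullet> (X11 *\<^sub>v x) = x \<bullet> (X11 *\<^sub>v x')" "z' \<bullet> (X22 *\<^sub>v z) = z \<bullet> (X22 *\<^sub>v z')"
    "w' \<bullet> (X33 *\<^sub>v w) = w \<bullet> (X33 *\<^sub>v w')" "u' \<bullet> (X44 *\<^sub>v u) = u \<bullet> (X44 *\<^sub>v u')"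
    using sp_sym[OF assms(1), of x' x] sp_sym[OF assms(2), of z' z] sp_sym[OF assms(3), of w' w]
      sp_sym[OF assms(4), of u' u] dims a1(2) a2(2) a3(2,3) b1(2) b2(2) b3(2,3) by simp_all
  then show "a \<bullet> (block4 n m k X11 X12 X22 X23 X24 X33 X44 *\<^sub>v b)
      = b \<bullet> (block4 n m k X11 X12 X22 X23 X24 X33 X44 *\<^sub>v a)"
    using a1 a2 a3 b1 b2 b3 by (simp add: block4_bilinear)
qed

end

lemma lyapunov_form:
  fixes P F :: "real mat"
  assumes "P\<^sup>T = P" "dim_row P = n" "dim_col P = n" "dim_row F = n" "dim_col F = n" "dim_vec x = n"
  shows "x \<bullet> ((P * F + F\<^sup>T * P) *\<^sub>v x) = 2 * (x \<bullet> (P *\<^sub>v (F *\<^sub>v x)))"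
proof -
  have "(P *\<^sub>v x) \<bullet> (F *\<^sub>v x) = x \<bullet> (P *\<^sub>v (F *\<^sub>v x))"
    using sp_sym[OF assms(1), of "F *\<^sub>v x" x] sp_comm[of "P *\<^sub>v x" "F *\<^sub>v x"] assms by simp
  then show ?thesis
    using assms by (simp add: mv_simps sp_simps sp_transpose)
qed

lemma gram_form: "dim_vec x = dim_col K \<Longrightarrow> x \<bullet> ((K\<^sup>T * K) *\<^sub>v x) = nsq (K *\<^sub>v x)" for K :: "real mat"
  by (simp add: mult_mv sp_transpose nsq_def)

lemma congruence_form:
  fixes X R :: "real mat"
  assumes "dim_row R = dim_row X" "dim_col R = dim_row X" "dim_vec x = dim_col X"
  shows "x \<bullet> ((X\<^sup>T * R * X) *\<^sub>v x) = (X *\<^sub>v x) \<bullet> (R *\<^sub>v (X *\<^sub>v x))"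
  using assms by (simp add: mult_mv sp_transpose sp_comm)

lemma dim_K_e [simp]: "dim_row (K_e M K) = 1" "dim_col (K_e M K) = M * dim_col K"
  by (simp_all add: K_e_def)

text \<open>The data of the closed-loop inequality.  The matrix \<open>\<Omega>\<close> below is the matrix that has to be negative
  definite, \<open>Xij\<close> are the blocks of its part \<open>\<Psi>\<^sub>0\<close>, and \<open>W = A - B K\<close> is the closed-loop matrix of the
  finite-dimensional state.\<close>

locale loop_data =
  fixes n M N :: nat and \<delta> r Q \<alpha> \<alpha>\<^sub>1 :: real
    and A B C L K P\<^sub>0 P\<^sub>e S\<^sub>e R\<^sub>e :: "real mat"
  assumes A: "dim_row A = n" "dim_col A = n" and B: "dim_row B = n" "dim_col B = 1"
    and C: "dim_row C = 1" "dim_col C = n" and L: "dim_row L = n" "dim_col L = 1"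
    and K: "dim_row K = 1" "dim_col K = n" and M: "M > 0"
    and P0: "P\<^sub>0\<^sup>T = P\<^sub>0" "dim_row P\<^sub>0 = n" "dim_col P\<^sub>0 = n"
    and Pe: "P\<^sub>e\<^sup>T = P\<^sub>e" "dim_row P\<^sub>e = M * n" "dim_col P\<^sub>e = M * n"
    and Se: "S\<^sub>e\<^sup>T = S\<^sub>e" "dim_row S\<^sub>e = M * n" "dim_col S\<^sub>e = M * n"
    and Re: "R\<^sub>e\<^sup>T = R\<^sub>e" "dim_row R\<^sub>e = M * n" "dim_col R\<^sub>e = M * n"
begin

abbreviation "\<epsilon> \<equiv> eps \<delta> r M"
abbreviation "F \<equiv> F_e M A L C"
abbreviation "G \<equiv> G_e M L C"

definition "W = A - B * K"
definition "X11 = P\<^sub>0 * W + W\<^sup>T * P\<^sub>0 + (2 * \<delta>) \<cdot>\<^sub>m P\<^sub>0 + (2 * \<alpha> / (real N * pi\<^sup>2)) \<cdot>\<^sub>m (K\<^sup>T * K)"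
definition "X12 = P\<^sub>0 * B * K_e M K"
definition "X22 = P\<^sub>e * F + F\<^sup>T * P\<^sub>e + (2 * \<delta>) \<cdot>\<^sub>m P\<^sub>e + (1 - \<epsilon>) \<cdot>\<^sub>m S\<^sub>e
               + (2 * \<alpha>\<^sub>1 / (real N * pi\<^sup>2)) \<cdot>\<^sub>m ((K_e M K)\<^sup>T * K_e M K)"
definition "X23 = P\<^sub>e * G - \<epsilon> \<cdot>\<^sub>m S\<^sub>e"
definition "X24 = P\<^sub>e * L_e M L"
definition "X33 = - (\<epsilon> \<cdot>\<^sub>m (S\<^sub>e + R\<^sub>e))"
definition "X44 = (- \<epsilon> * Q) \<cdot>\<^sub>m (1\<^sub>m 1 :: real mat)"
definition "\<Lambda> = Lambda0 M A L C"
definition "\<Omega> = Psi0 \<delta> r M N A B C L K P\<^sub>0 P\<^sub>e S\<^sub>e R\<^sub>e Q \<alpha> \<alpha>\<^sub>1 + (r / real M)\<^sup>2 \<cdot>\<^sub>m (\<Lambda>\<^sup>T * R\<^sub>e * \<Lambda>)"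

lemma FGL_dims:
  "dim_row F = M * n" "dim_col F = M * n" "dim_row G = M * n" "dim_col G = M * n"
  "dim_row (L_e M L) = M * n" "dim_col (L_e M L) = 1"
  using C L M by simp_all

lemma X_dims:
  "dim_row W = n" "dim_col W = n"
  "dim_row X11 = n" "dim_col X11 = n" "dim_row X12 = n" "dim_col X12 = M * n"
  "dim_row X22 = M * n" "dim_col X22 = M * n" "dim_row X23 = M * n" "dim_col X23 = M * n"
  "dim_row X24 = M * n" "dim_col X24 = 1" "dim_row X33 = M * n" "dim_col X33 = M * n"
  "dim_row X44 = 1" "dim_col X44 = 1"
  using B C L K M P0(2,3) Pe(2,3) Se(2,3) Re(2,3)
  by (simp_all add: W_def X11_def X12_def X22_def X23_def X24_def X33_def X44_def)

lemma \<Lambda>_dims: "dim_row \<Lambda> = M * n" "dim_col \<Lambda> = n + (M * n + (M * n + 1))"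
  unfolding \<Lambda>_def Lambda0_def using A C L M by simp_all

lemma \<Omega>_eq: "\<Omega> = block4 n (M * n) 1 X11 X12 X22 X23 X24 X33 X44 + (r / real M)\<^sup>2 \<cdot>\<^sub>m (\<Lambda>\<^sup>T * R\<^sub>e * \<Lambda>)"
  by (simp only: \<Omega>_def Psi0_def Let_def block4_def A X11_def X12_def X22_def X23_def X24_def X33_def
      X44_def W_def)

lemma \<Omega>_dims: "dim_row \<Omega> = n + (M * n + (M * n + 1))" "dim_col \<Omega> = n + (M * n + (M * n + 1))"
  unfolding \<Omega>_eq using \<Lambda>_dims by simp_all

lemma \<Omega>_sym: "\<Omega>\<^sup>T = \<Omega>"
proof -
  have "X11\<^sup>T = X11"
    unfolding X11_def using P0(2,3) X_dims(1,2) K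
    by (intro sym_add sym_lyapunov sym_smult sym_gram P0(1)) simp_all
  moreover have "X22\<^sup>T = X22"
    unfolding X22_def using Pe(2,3) Se(2,3) FGL_dims K
    by (intro sym_add sym_lyapunov sym_smult sym_gram Pe(1) Se(1)) simp_all
  moreover have "X33\<^sup>T = X33"
    unfolding X33_def using Se(2,3) Re(2,3) by (intro sym_uminus sym_smult sym_add Se(1) Re(1)) simp_all
  moreover have "X44\<^sup>T = X44"
    unfolding X44_def by (intro sym_smult transpose_one)
  ultimately have "(block4 n (M * n) 1 X11 X12 X22 X23 X24 X33 X44)\<^sup>T = block4 n (M * n) 1 X11 X12 X22 X23 X24 X33 X44"
    by (rule block4_sym[OF X_dims(3-)])
  then show ?thesis
    unfolding \<Omega>_eq using Re(2,3) \<Lambda>_dims dim_block4[OF X_dims(3-)]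
    by (intro sym_add sym_smult sym_congruence Re(1)) simp_all
qed

text \<open>The summands that involve only \<open>z\<close>, \<open>w\<close> and \<open>u\<close>, apart from those with \<open>K\<^sub>e\<close> and \<open>Q\<close>, add up to
  the delay form of the large system.\<close>

lemma \<Omega>_form:
  assumes x: "dim_vec x = n" and z: "dim_vec z = M * n" and w: "dim_vec w = M * n" and u: "dim_vec u = 1"
  shows "(x @\<^sub>v (z @\<^sub>v (w @\<^sub>v u))) \<bullet> (\<Omega> *\<^sub>v (x @\<^sub>v (z @\<^sub>v (w @\<^sub>v u))))
    = 2 * (x \<bullet> (P\<^sub>0 *\<^sub>v (W *\<^sub>v x))) + 2 * \<delta> * (x \<bullet> (P\<^sub>0 *\<^sub>v x))
      + 2 * (x \<bullet> (P\<^sub>0 *\<^sub>v (B *\<^sub>v (K_e M K *\<^sub>v z))))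
      + 2 * \<alpha> / (real N * pi\<^sup>2) * nsq (K *\<^sub>v x) + 2 * \<alpha>\<^sub>1 / (real N * pi\<^sup>2) * nsq (K_e M K *\<^sub>v z)
      + dform \<delta> \<epsilon> (r / real M) P\<^sub>e S\<^sub>e R\<^sub>e z w (F *\<^sub>v z + G *\<^sub>v w + L_e M L *\<^sub>v u)
      - \<epsilon> * Q * nsq u"
proof -
  define v where "v = x @\<^sub>v (z @\<^sub>v (w @\<^sub>v u))"
  define f where "f = F *\<^sub>v z + G *\<^sub>v w + L_e M L *\<^sub>v u"
  have v: "dim_vec v = n + (M * n + (M * n + 1))"
    using x z w u by (simp add: v_def)
  have "\<Lambda> *\<^sub>v v = 0\<^sub>v (M * n) + (F *\<^sub>v z + (G *\<^sub>v w + L_e M L *\<^sub>v u))"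
    unfolding \<Lambda>_def Lambda0_def v_def using A C L M x z w u
    by (simp add: append_cols_mv zero_mv)
  also have "\<dots> = f"
    unfolding f_def using C L M by (intro eq_vecI) (simp_all del: index_mult_mat_vec)
  finally have \<Lambda>v: "\<Lambda> *\<^sub>v v = f" .
  have "v \<bullet> (\<Omega> *\<^sub>v v) = v \<bullet> (block4 n (M * n) 1 X11 X12 X22 X23 X24 X33 X44 *\<^sub>v v)
      + (r / real M)\<^sup>2 * (v \<bullet> ((\<Lambda>\<^sup>T * R\<^sub>e * \<Lambda>) *\<^sub>v v))"
    unfolding \<Omega>_eq using v \<Lambda>_dims dim_block4[OF X_dims(3-)] by (simp add: add_mv smult_mv sp_add_right)
  also have "v \<bullet> ((\<Lambda>\<^sup>T * R\<^sub>e * \<Lambda>) *\<^sub>v v) = f \<bullet> (R\<^sub>e *\<^sub>v f)"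
    using v \<Lambda>_dims Re(2,3) by (subst congruence_form) (simp_all add: \<Lambda>v)
  also have "v \<bullet> (block4 n (M * n) 1 X11 X12 X22 X23 X24 X33 X44 *\<^sub>v v)
    = x \<bullet> (X11 *\<^sub>v x) + 2 * (x \<bullet> (X12 *\<^sub>v z)) + z \<bullet> (X22 *\<^sub>v z)
      + 2 * (z \<bullet> (X23 *\<^sub>v w)) + 2 * (z \<bullet> (X24 *\<^sub>v u)) + w \<bullet> (X33 *\<^sub>v w) + u \<bullet> (X44 *\<^sub>v u)"
    unfolding v_def using block4_bilinear[OF X_dims(3-) x z w u x z w u] by simp
  also have "x \<bullet> (X11 *\<^sub>v x) = 2 * (x \<bullet> (P\<^sub>0 *\<^sub>v (W *\<^sub>v x))) + 2 * \<delta> * (x \<bullet> (P\<^sub>0 *\<^sub>v x))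
      + 2 * \<alpha> / (real N * pi\<^sup>2) * nsq (K *\<^sub>v x)"
  proof -
    have "x \<bullet> (X11 *\<^sub>v x) = x \<bullet> ((P\<^sub>0 * W + W\<^sup>T * P\<^sub>0) *\<^sub>v x) + 2 * \<delta> * (x \<bullet> (P\<^sub>0 *\<^sub>v x))
        + 2 * \<alpha> / (real N * pi\<^sup>2) * (x \<bullet> ((K\<^sup>T * K) *\<^sub>v x))"
      unfolding X11_def using x P0(2,3) K X_dims(1,2)
      by (subst add_mv, simp, simp, simp, subst add_mv, simp, simp, simp)
         (simp add: smult_mv sp_add_right)
    then show ?thesis
      using lyapunov_form[OF P0 X_dims(1,2) x] gram_form[of x K] x K by simp
  qed
  also have "x \<bullet> (X12 *\<^sub>v z) = x \<bullet> (P\<^sub>0 *\<^sub>v (B *\<^sub>v (K_e M K *\<^sub>v z)))"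
    unfolding X12_def using z P0(2,3) B K by (simp add: mult_mv)
  also have "z \<bullet> (X22 *\<^sub>v z) = 2 * (z \<bullet> (P\<^sub>e *\<^sub>v (F *\<^sub>v z))) + 2 * \<delta> * (z \<bullet> (P\<^sub>e *\<^sub>v z))
      + (1 - \<epsilon>) * (z \<bullet> (S\<^sub>e *\<^sub>v z)) + 2 * \<alpha>\<^sub>1 / (real N * pi\<^sup>2) * nsq (K_e M K *\<^sub>v z)"
  proof -
    have "z \<bullet> (X22 *\<^sub>v z) = z \<bullet> ((P\<^sub>e * F + F\<^sup>T * P\<^sub>e) *\<^sub>v z) + 2 * \<delta> * (z \<bullet> (P\<^sub>e *\<^sub>v z))
        + (1 - \<epsilon>) * (z \<bullet> (S\<^sub>e *\<^sub>v z)) + 2 * \<alpha>\<^sub>1 / (real N * pi\<^sup>2) * (z \<bullet> (((K_e M K)\<^sup>T * K_e M K) *\<^sub>v z))"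
      unfolding X22_def using z Pe(2,3) Se(2,3) K FGL_dims
      by (subst add_mv, simp, simp, simp, subst add_mv, simp, simp, simp, subst add_mv, simp, simp, simp)
         (simp add: smult_mv sp_add_right)
    then show ?thesis
      using lyapunov_form[OF Pe FGL_dims(1,2) z] gram_form[of z "K_e M K"] z K by simp
  qed
  also have "z \<bullet> (X23 *\<^sub>v w) = z \<bullet> (P\<^sub>e *\<^sub>v (G *\<^sub>v w)) - \<epsilon> * (z \<bullet> (S\<^sub>e *\<^sub>v w))"
    unfolding X23_def using z w Pe(2,3) Se(2,3) C L M by (simp add: mv_simps sp_simps)
  also have "z \<bullet> (X24 *\<^sub>v u) = z \<bullet> (P\<^sub>e *\<^sub>v (L_e M L *\<^sub>v u))"
    unfolding X24_def using u Pe(2,3) C L M by (simp add: mult_mv)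
  also have "w \<bullet> (X33 *\<^sub>v w) = - \<epsilon> * (w \<bullet> (S\<^sub>e *\<^sub>v w)) - \<epsilon> * (w \<bullet> (R\<^sub>e *\<^sub>v w))"
    unfolding X33_def using w Se(2,3) Re(2,3) by (simp add: mv_simps sp_simps algebra_simps)
  also have "u \<bullet> (X44 *\<^sub>v u) = - \<epsilon> * Q * nsq u"
    unfolding X44_def using u by (simp add: smult_mv one_mv nsq_def)
  finally have "v \<bullet> (\<Omega> *\<^sub>v v) =
      2 * (x \<bullet> (P\<^sub>0 *\<^sub>v (W *\<^sub>v x))) + 2 * \<delta> * (x \<bullet> (P\<^sub>0 *\<^sub>v x)) + 2 * \<alpha> / (real N * pi\<^sup>2) * nsq (K *\<^sub>v x)
      + 2 * (x \<bullet> (P\<^sub>0 *\<^sub>v (B *\<^sub>v (K_e M K *\<^sub>v z))))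
      + (2 * (z \<bullet> (P\<^sub>e *\<^sub>v (F *\<^sub>v z))) + 2 * \<delta> * (z \<bullet> (P\<^sub>e *\<^sub>v z))
         + (1 - \<epsilon>) * (z \<bullet> (S\<^sub>e *\<^sub>v z)) + 2 * \<alpha>\<^sub>1 / (real N * pi\<^sup>2) * nsq (K_e M K *\<^sub>v z))
      + 2 * (z \<bullet> (P\<^sub>e *\<^sub>v (G *\<^sub>v w)) - \<epsilon> * (z \<bullet> (S\<^sub>e *\<^sub>v w)))
      + 2 * (z \<bullet> (P\<^sub>e *\<^sub>v (L_e M L *\<^sub>v u)))
      + (- \<epsilon> * (w \<bullet> (S\<^sub>e *\<^sub>v w)) - \<epsilon> * (w \<bullet> (R\<^sub>e *\<^sub>v w))) + - \<epsilon> * Q * nsq u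
      + (r / real M)\<^sup>2 * (f \<bullet> (R\<^sub>e *\<^sub>v f))" .
  moreover have "z \<bullet> (P\<^sub>e *\<^sub>v f) = z \<bullet> (P\<^sub>e *\<^sub>v (F *\<^sub>v z)) + z \<bullet> (P\<^sub>e *\<^sub>v (G *\<^sub>v w)) + z \<bullet> (P\<^sub>e *\<^sub>v (L_e M L *\<^sub>v u))"
    unfolding f_def using Pe(2,3) C L M by (simp add: mv_add sp_add_right)
  moreover have "(z + w) \<bullet> (S\<^sub>e *\<^sub>v (z + w)) = z \<bullet> (S\<^sub>e *\<^sub>v z) + 2 * (z \<bullet> (S\<^sub>e *\<^sub>v w)) + w \<bullet> (S\<^sub>e *\<^sub>v w)"
    using Se(2,3) z w sp_sym[OF Se(1), of z w] by (simp add: mv_simps sp_simps)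
  ultimately show ?thesis
    unfolding dform_def f_def[symmetric] v_def[symmetric] by (simp add: algebra_simps)
qed

end

section \<open>The tail inequality\<close>

text \<open>With \<open>\<alpha> = \<alpha>\<^sub>1 = 4\<close> both products with the first coordinate are absorbed by the diagonal, at the
  price of adding \<open>\<lambda>\<^sub>N\<^sub>+\<^sub>1 / 2\<close> to the first diagonal entry.\<close>

lemma tail_LMI_neg_def:
  assumes neg: "- lam (N + 1) / 2 + q + \<delta> + Q * tail_norm_sq c N / 2 < 0"
  shows "neg_def 3 (tail_LMI q \<delta> c N Q 4 4)"
proof -
  define l where "l = lam (N + 1)"
  have l: "l > 0" by (simp add: l_def lam_def)
  define a where "a = - l + q + \<delta> + Q * tail_norm_sq c N / 2"
  have a: "a + l / 2 < 0" using neg by (simp add: a_def l_def)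
  define T where "T = tail_LMI q \<delta> c N Q 4 4"
  have T_eq: "T = mat_of_rows_list 3 [[a, 1, 1], [1, - (8 / l), 0], [1, 0, - (8 / l)]]"
    by (simp add: T_def tail_LMI_def a_def l_def)
  have T: "dim_row T = 3" "dim_col T = 3"
    by (simp_all add: T_eq mat_of_rows_list_def)
  have form: "x \<bullet> (T *\<^sub>v y) = a * (x $ 0 * y $ 0) + x $ 0 * y $ 1 + x $ 1 * y $ 0 + x $ 0 * y $ 2 + x $ 2 * y $ 0
      - 8 / l * (x $ 1 * y $ 1) - 8 / l * (x $ 2 * y $ 2)"
    if "dim_vec x = 3" "dim_vec y = 3" for x y
    using that T by (simp add: sp_sum[of x] mv_index lessThan_Suc numeral_3_eq_3 numeral_2_eq_2
        T_eq mat_of_rows_list_def algebra_simps del: index_mult_mat_vec)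
  have "v \<bullet> (T *\<^sub>v v) < 0" if v: "dim_vec v = 3" "v \<noteq> 0\<^sub>v 3" for v
  proof -
    define x y z where "x = v $ 0" "y = v $ 1" "z = v $ 2"
    have *: "2 * (x * t) \<le> 4 / l * t\<^sup>2 + l / 4 * x\<^sup>2" for t
    proof -
      have "0 \<le> (4 * t - l * x)\<^sup>2 / (4 * l)" using l by simp
      also have "\<dots> = 4 / l * t\<^sup>2 + l / 4 * x\<^sup>2 - 2 * (x * t)"
        using l by (simp add: power2_eq_square field_simps)
      finally show ?thesis by simp
    qed
    have "v \<bullet> (T *\<^sub>v v) = a * x\<^sup>2 + 2 * (x * y) + 2 * (x * z) - 8 / l * y\<^sup>2 - 8 / l * z\<^sup>2"
      using form[OF v(1) v(1)] by (simp add: x_y_z_def power2_eq_square)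
    also have "\<dots> \<le> (a + l / 2) * x\<^sup>2 - 4 / l * y\<^sup>2 - 4 / l * z\<^sup>2"
      using *[of y] *[of z] by (simp add: algebra_simps)
    also have "\<dots> < 0"
    proof -
      have "x \<noteq> 0 \<or> y \<noteq> 0 \<or> z \<noteq> 0"
      proof (rule ccontr)
        assume "\<not> ?thesis"
        then have "v = 0\<^sub>v 3"
          using v(1) by (intro eq_vecI) (auto simp: x_y_z_def numeral_3_eq_3 numeral_2_eq_2 less_Suc_eq)
        with v(2) show False ..
      qed
      moreover have "(a + l / 2) * x\<^sup>2 \<le> 0" "x \<noteq> 0 \<Longrightarrow> (a + l / 2) * x\<^sup>2 < 0"
        using a by (simp_all add: mult_nonpos_nonneg mult_neg_pos)
      moreover have "0 \<le> 4 / l * t\<^sup>2" "t \<noteq> 0 \<Longrightarrow> 0 < 4 / l * t\<^sup>2" for t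
        using l by simp_all
      ultimately show ?thesis by (smt (verit))
    qed
    finally show ?thesis .
  qed
  moreover have "T\<^sup>T = T"
    by (rule sym_if_bilinear_sym[OF T]) (simp add: form mult.commute)
  ultimately show ?thesis
    unfolding neg_def_def T_def[symmetric] using T by (auto intro!: carrier_matI dest: carrier_vecD)
qed

section \<open>Bessel's inequality for the cosine system\<close>

lemma integrable_continuous_unit:
  fixes f :: "real \<Rightarrow> real"
  assumes "continuous_on {0..1} f"
  shows "integrable (lebesgue_on {0<..<1}) f"
proof -
  have "integrable (lebesgue_on {0..1}) f"
    using assms by (intro continuous_imp_integrable_real)
  then have "set_integrable lebesgue {0..1} f"
    by (simp add: set_integrable_def integrable_restrict_space)
  then have "set_integrable lebesgue {0<..<1} f"
    by (rule set_integrable_subset) auto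
  then show ?thesis
    by (simp add: set_integrable_def integrable_restrict_space)
qed

lemma integral_cos:
  "integral\<^sup>L (lebesgue_on {0<..<1}) (\<lambda>x. cos (of_int k * pi * x)) = (if k = 0 then 1 else 0)"
proof -
  have "((\<lambda>x. cos (of_int k * pi * x)) has_integral (if k = 0 then 1 else 0)) {0..1}"
  proof (cases "k = 0")
    case True
    then show ?thesis
      using has_integral_const_real[of "1::real" 0 1] by simp
  next
    case False
    have "((\<lambda>x. cos (of_int k * pi * x)) has_integral
        (sin (of_int k * pi * 1) / (of_int k * pi) - sin (of_int k * pi * 0) / (of_int k * pi))) {0..1}"
      using False
      by (intro fundamental_theorem_of_calculus)
        (auto intro!: derivative_eq_intros simp flip: has_real_derivative_iff_has_vector_derivative)
    moreover have "sin (of_int k * pi) = 0"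
      by (metis sin_npi_int mult.commute)
    ultimately show ?thesis
      using False by simp
  qed
  then have "integral {0<..<1} (\<lambda>x. cos (of_int k * pi * x)) = (if k = 0 then 1 else 0)"
    unfolding integral_open_interval_real[symmetric] by (rule integral_unique)
  moreover have "integrable (lebesgue_on {0<..<1}) (\<lambda>x. cos (of_int k * pi * x))"
    by (intro integrable_continuous_unit continuous_intros)
  ultimately show ?thesis
    by (simp add: lebesgue_integral_eq_integral)
qed

lemma continuous_phi: "continuous_on X (phi n)"
  unfolding phi_def by (cases "n = 0") (auto intro!: continuous_intros)

lemma phi_orthonormal:
  "integral\<^sup>L (lebesgue_on {0<..<1}) (\<lambda>x. phi m x * phi n x) = (if m = n then 1 else 0)"
proof -
  define w where "w n = (if n = 0 then 1 else sqrt 2)" for n :: nat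
  have phi: "phi n x = w n * cos (real n * pi * x)" for n x
    by (simp add: phi_def w_def)
  let ?c = "\<lambda>k::int. \<lambda>x. cos (of_int k * pi * x)"
  have "(\<lambda>x. phi m x * phi n x)
      = (\<lambda>x. w m * w n / 2 * (?c (int m - int n) x + ?c (int m + int n) x))"
    by (rule ext) (simp add: phi cos_times_cos algebra_simps add_divide_distrib)
  moreover have "integrable (lebesgue_on {0<..<1}) (?c k)" for k
    by (intro integrable_continuous_unit continuous_intros)
  ultimately have "integral\<^sup>L (lebesgue_on {0<..<1}) (\<lambda>x. phi m x * phi n x)
      = w m * w n / 2 * ((if int m - int n = 0 then 1 else 0) + (if int m + int n = 0 then 1 else 0))"
    by (simp only: Bochner_Integration.integral_mult_right_zero Bochner_Integration.integral_add integral_cos)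
  also have "\<dots> = (if m = n then 1 else 0)"
    by (auto simp: w_def)
  finally show ?thesis .
qed

lemma integrable_L2_mult:
  assumes c: "L2_01 c" and g: "continuous_on {0..1} g"
  shows "integrable (lebesgue_on {0<..<1}) (\<lambda>x. c x * g x)"
proof (rule Bochner_Integration.integrable_bound)
  let ?M = "lebesgue_on {0<..<1::real}"
  have "integrable ?M (\<lambda>x. (g x)\<^sup>2)"
    using g by (intro integrable_continuous_unit continuous_intros)
  then show "integrable ?M (\<lambda>x. ((c x)\<^sup>2 + (g x)\<^sup>2) / 2)"
    using c by (simp add: L2_01_def)
  have "g \<in> borel_measurable ?M"
    using integrable_continuous_unit[OF g] by (rule borel_measurable_integrable)
  then show "(\<lambda>x. c x * g x) \<in> borel_measurable ?M"
    using c by (intro borel_measurable_times) (simp_all add: L2_01_def)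
  have "\<bar>a * b\<bar> \<le> (a\<^sup>2 + b\<^sup>2) / 2" for a b :: real
    using sum_squares_bound[of a b] sum_squares_bound[of a "- b"] by (simp add: abs_le_iff)
  then show "AE x in ?M. norm (c x * g x) \<le> norm (((c x)\<^sup>2 + (g x)\<^sup>2) / 2)"
    by (intro AE_I2) simp
qed

lemma bessel:
  assumes c: "L2_01 c"
  shows "(\<Sum>n<K. (c_coeff c n)\<^sup>2) \<le> integral\<^sup>L (lebesgue_on {0<..<1}) (\<lambda>x. (c x)\<^sup>2)"
proof -
  let ?M = "lebesgue_on {0<..<1::real}"
  define a where "a n = c_coeff c n" for n
  have a: "integral\<^sup>L ?M (\<lambda>x. c x * phi n x) = a n" for n
    by (simp add: a_def c_coeff_def inner_L2_def)
  define g where "g x = (\<Sum>n<K. a n * phi n x)" for x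
  have cg: "integral\<^sup>L ?M (\<lambda>x. c x * g x) = (\<Sum>n<K. (a n)\<^sup>2)"
  proof -
    have "integral\<^sup>L ?M (\<lambda>x. c x * g x) = integral\<^sup>L ?M (\<lambda>x. \<Sum>n<K. a n * (c x * phi n x))"
      by (simp add: g_def sum_distrib_left mult.left_commute)
    also have "\<dots> = (\<Sum>n<K. integral\<^sup>L ?M (\<lambda>x. a n * (c x * phi n x)))"
      by (intro Bochner_Integration.integral_sum integrable_mult_right integrable_L2_mult c continuous_phi)
    also have "\<dots> = (\<Sum>n<K. (a n)\<^sup>2)"
      by (simp add: a power2_eq_square)
    finally show ?thesis .
  qed
  have gg: "integral\<^sup>L ?M (\<lambda>x. (g x)\<^sup>2) = (\<Sum>n<K. (a n)\<^sup>2)"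
  proof -
    have "(g x)\<^sup>2 = (\<Sum>m<K. \<Sum>n<K. a m * a n * (phi m x * phi n x))" for x
      by (simp add: g_def power2_eq_square sum_product mult.assoc mult.left_commute)
    then have "integral\<^sup>L ?M (\<lambda>x. (g x)\<^sup>2)
        = integral\<^sup>L ?M (\<lambda>x. \<Sum>m<K. \<Sum>n<K. a m * a n * (phi m x * phi n x))"
      by simp
    also have "\<dots> = (\<Sum>m<K. \<Sum>n<K. integral\<^sup>L ?M (\<lambda>x. a m * a n * (phi m x * phi n x)))"
    proof -
      have "integrable ?M (\<lambda>x. a m * a n * (phi m x * phi n x))" for m n
        by (intro integrable_continuous_unit continuous_intros continuous_phi)
      then show ?thesis
        by (simp only: Bochner_Integration.integral_sum Bochner_Integration.integrable_sum)
    qed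
    also have "\<dots> = (\<Sum>m<K. \<Sum>n<K. if m = n then a m * a n else 0)"
      by (intro sum.cong refl) (simp add: phi_orthonormal)
    also have "\<dots> = (\<Sum>n<K. (a n)\<^sup>2)"
      by (simp add: power2_eq_square)
    finally show ?thesis .
  qed
  have g: "continuous_on {0..1} g"
    unfolding g_def by (intro continuous_intros continuous_phi)
  have int: "integrable ?M (\<lambda>x. (c x)\<^sup>2)"
    using c by (simp add: L2_01_def)
  have int': "integrable ?M (\<lambda>x. (g x)\<^sup>2)"
    by (intro integrable_continuous_unit continuous_intros g)
  have "0 \<le> integral\<^sup>L ?M (\<lambda>x. (c x - g x)\<^sup>2)"
    by (intro integral_nonneg_AE AE_I2) simp
  also have "(\<lambda>x. (c x - g x)\<^sup>2) = (\<lambda>x. (c x)\<^sup>2 - 2 * (c x * g x) + (g x)\<^sup>2)"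
    by (auto simp: power2_diff)
  also have "integral\<^sup>L ?M \<dots> = integral\<^sup>L ?M (\<lambda>x. (c x)\<^sup>2) - 2 * (\<Sum>n<K. (a n)\<^sup>2) + (\<Sum>n<K. (a n)\<^sup>2)"
    using int int' integrable_L2_mult[OF c g] by (simp add: cg gg)
  finally show ?thesis
    by (simp add: a_def)
qed

lemma tail_norm_sq_le:
  assumes c: "L2_01 c"
  shows "tail_norm_sq c N \<le> integral\<^sup>L (lebesgue_on {0<..<1}) (\<lambda>x. (c x)\<^sup>2)" (is "_ \<le> ?I")
proof -
  have partial: "(\<Sum>k<K. (c_coeff c (N + 1 + k))\<^sup>2) \<le> ?I" for K
  proof -
    have "(\<Sum>k<K. (c_coeff c (N + 1 + k))\<^sup>2) = (\<Sum>j\<in>{N + 1..<N + 1 + K}. (c_coeff c j)\<^sup>2)"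
      by (rule sum.reindex_bij_witness[of _ "\<lambda>j. j - (N + 1)" "\<lambda>k. N + 1 + k"]) auto
    also have "\<dots> \<le> (\<Sum>j<N + 1 + K. (c_coeff c j)\<^sup>2)"
      by (intro sum_mono2) auto
    also have "\<dots> \<le> ?I"
      by (rule bessel[OF c])
    finally show ?thesis .
  qed
  have "summable (\<lambda>k. (c_coeff c (N + 1 + k))\<^sup>2)"
    using partial by (intro summableI_nonneg_bounded) auto
  then show ?thesis
    unfolding tail_norm_sq_def using partial by (rule suminf_le_const)
qed

section \<open>Feasibility\<close>

text \<open>A solution for the delay \<open>h\<close> is a solution for every smaller delay, with the same decay rate in
  \<open>\<bar>x\<bar>\<^sup>2 + \<bar>y\<bar>\<^sup>2\<close>.\<close>

lemma delay_LMI_coercive: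
  fixes A L C P S R :: "real mat"
  assumes A: "dim_row A = n" "dim_col A = n" and L: "dim_row L = n" "dim_col L = 1"
    and C: "dim_row C = 1" "dim_col C = n"
    and P: "pos_def n P" and S: "pos_def n S" and R: "pos_def n R"
    and neg: "neg_def (2 * n) (delay_LMI \<delta> h A L C P S R)"
    and \<tau>: "0 \<le> \<tau>" "\<tau> \<le> h" and \<delta>: "\<delta> > 0"
  obtains \<kappa> where "\<kappa> > 0"
    "\<And>x y. dim_vec x = n \<Longrightarrow> dim_vec y = n \<Longrightarrow>
      dform \<delta> (exp (- 2 * \<delta> * \<tau>)) \<tau> P S R x y ((A - L * C) *\<^sub>v x - (L * C) *\<^sub>v y) \<le> - \<kappa> * (nsq x + nsq y)"
proof -
  obtain \<kappa> where \<kappa>: "\<kappa> > 0" "\<And>v. dim_vec v = 2 * n \<Longrightarrow>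
      v \<bullet> (delay_LMI \<delta> h A L C P S R *\<^sub>v v) \<le> - \<kappa> * nsq v"
    using neg_def_coercive[OF neg] by blast
  show thesis
  proof (rule that[OF \<kappa>(1)])
    fix x y :: "real vec" assume x: "dim_vec x = n" and y: "dim_vec y = n"
    let ?f = "(A - L * C) *\<^sub>v x - (L * C) *\<^sub>v y"
    have f: "dim_vec ?f = n" using L by simp
    have xy: "dim_vec (x + y) = n" using y by simp
    have e: "exp (- 2 * \<delta> * h) \<le> exp (- 2 * \<delta> * \<tau>)"
      using \<tau> \<delta> by simp
    have "dform \<delta> (exp (- 2 * \<delta> * \<tau>)) \<tau> P S R x y ?f \<le> dform \<delta> (exp (- 2 * \<delta> * h)) h P S R x y ?f"
      using \<tau> by (intro dform_mono e power_mono pos_def_dest(4)[OF S xy] pos_def_dest(4)[OF R y]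
          pos_def_dest(4)[OF R f]) simp_all
    also have "\<dots> = (x @\<^sub>v y) \<bullet> (delay_LMI \<delta> h A L C P S R *\<^sub>v (x @\<^sub>v y))"
      using delay_LMI_form[OF A L C pos_def_dest(1,2,3)[OF P] pos_def_dest(1,2,3)[OF S]
          pos_def_dest(1,2,3)[OF R] x y] by simp
    also have "\<dots> \<le> - \<kappa> * nsq (x @\<^sub>v y)"
      using x y by (intro \<kappa>(2)) simp
    finally show "dform \<delta> (exp (- 2 * \<delta> * \<tau>)) \<tau> P S R x y ?f \<le> - \<kappa> * (nsq x + nsq y)"
      by (simp add: nsq_append)
  qed
qed

text \<open>The decision variables are independent of \<open>N\<close>.  For \<open>Q\<close> this is essential, since \<open>Q \<parallel>c\<parallel>\<^sub>N\<^sup>2\<close> has to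
  stay bounded in the first inequality.\<close>

lemma loop_LMI_feasible:
  fixes A B C L K P S R :: "real mat"
  assumes A: "dim_row A = n" "dim_col A = n" and B: "dim_row B = n" "dim_col B = 1"
    and C: "dim_row C = 1" "dim_col C = n" and L: "dim_row L = n" "dim_col L = 1"
    and K: "dim_row K = 1" "dim_col K = n" and M: "M > 0"
    and Pc: "pos_def n Pc"
      "neg_def n (Pc * (A - B * K) + (A - B * K)\<^sup>T * Pc - (- 2 * \<delta>) \<cdot>\<^sub>m Pc)"
    and P: "pos_def n P" and S: "pos_def n S" and R: "pos_def n R"
    and neg: "neg_def (2 * n) (delay_LMI \<delta> h A L C P S R)"
    and r: "r > 0" "r / real M \<le> h" and \<delta>: "\<delta> > 0" and \<alpha>: "\<alpha> > 0"
  obtains P\<^sub>0 P\<^sub>e S\<^sub>e R\<^sub>e Q N1 where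
    "pos_def n P\<^sub>0" "pos_def (M * n) P\<^sub>e" "pos_def (M * n) S\<^sub>e" "pos_def (M * n) R\<^sub>e" "Q > 0"
    "\<And>N. N > N1 \<Longrightarrow> neg_def (n + M * n + M * n + 1) (Psi0 \<delta> r M N A B C L K P\<^sub>0 P\<^sub>e S\<^sub>e R\<^sub>e Q \<alpha> \<alpha>
      + (r / real M)\<^sup>2 \<cdot>\<^sub>m ((Lambda0 M A L C)\<^sup>T * R\<^sub>e * Lambda0 M A L C))"
proof -
  define Acl where "Acl = A - B * K"
  have Acl: "dim_row Acl = n" "dim_col Acl = n"
    using B K by (simp_all add: Acl_def)
  have \<tau>: "0 \<le> r / real M"
    using r by simp
  have eps: "eps \<delta> r M = exp (- 2 * \<delta> * (r / real M))"
    by (simp add: eps_def)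
  obtain \<kappa> where \<kappa>: "\<kappa> > 0" "\<And>x y. dim_vec x = n \<Longrightarrow> dim_vec y = n \<Longrightarrow>
      dform \<delta> (eps \<delta> r M) (r / real M) P S R x y ((A - L * C) *\<^sub>v x - (L * C) *\<^sub>v y) \<le> - \<kappa> * (nsq x + nsq y)"
    using delay_LMI_coercive[OF A L C P S R neg \<tau> r(2) \<delta>] unfolding eps by blast
  obtain s Cu where s: "\<And>i. s i > 0" and Cu: "Cu \<ge> 0"
    and cascade: "\<And>z w u. dim_vec z = M * n \<Longrightarrow> dim_vec w = M * n \<Longrightarrow> dim_vec u = 1 \<Longrightarrow>
      dform \<delta> (eps \<delta> r M) (r / real M) (mat_diag M s \<otimes>\<^sub>K P) (mat_diag M s \<otimes>\<^sub>K S) (mat_diag M s \<otimes>\<^sub>K R) z w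
        (F_e M A L C *\<^sub>v z + G_e M L C *\<^sub>v w + L_e M L *\<^sub>v u)
      \<le> - (\<kappa> / 4) * (nsq z + nsq w) + Cu * nsq u"
    using dform_cascade[OF A L C pos_def_dest(2,3)[OF P] pos_def_dest(2,3)[OF S]
        pos_def_dest(1,2,3)[OF R] M \<kappa>] by blast
  obtain k where k: "k > 0" "\<And>x. dim_vec x = n \<Longrightarrow>
      x \<bullet> ((Pc * Acl + Acl\<^sup>T * Pc - (- 2 * \<delta>) \<cdot>\<^sub>m Pc) *\<^sub>v x) \<le> - k * nsq x"
    using neg_def_coercive[OF Pc(2)] unfolding Acl_def by blast
  define Y where "Y = Pc * B * K_e M K"
  \<comment> \<open>The cascade leaves the decay \<open>\<kappa>4\<close> in \<open>z\<close>: the scaling \<open>\<rho>\<close> of \<open>Pc\<close> keeps the cross term below half of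
    it, and \<open>\<eta>\<close> is the size of the coefficient \<open>2 \<alpha> / (N \<pi>\<^sup>2)\<close> that costs at most another quarter of
    the decay in \<open>z\<close>, and a quarter of the decay in \<open>x\<close>.\<close>
  define \<kappa>4 where "\<kappa>4 = \<kappa> / 4"
  define \<rho> where "\<rho> = \<kappa>4 * k / (4 * (frob Y + 1))"
  define \<eta> where "\<eta> = min (\<rho> * k / (4 * (frob K + 1))) (\<kappa>4 / (4 * (frob (K_e M K) + 1)))"
  define Q where "Q = (Cu + 1) / eps \<delta> r M"
  define N1 where "N1 = nat \<lceil>2 * \<alpha> / \<eta>\<rceil>"
  define P\<^sub>0 where "P\<^sub>0 = \<rho> \<cdot>\<^sub>m Pc"
  define P\<^sub>e where "P\<^sub>e = mat_diag M s \<otimes>\<^sub>K P"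
  define S\<^sub>e where "S\<^sub>e = mat_diag M s \<otimes>\<^sub>K S"
  define R\<^sub>e where "R\<^sub>e = mat_diag M s \<otimes>\<^sub>K R"
  have pos: "frob X + 1 > 0" for X
    using frob_ge_0[of X] by linarith
  have \<kappa>4: "\<kappa>4 > 0" and eps_pos: "eps \<delta> r M > 0"
    using \<kappa>(1) by (simp_all add: \<kappa>4_def eps)
  have \<rho>: "\<rho> > 0"
    unfolding \<rho>_def by (intro divide_pos_pos mult_pos_pos \<kappa>4 k(1) pos) simp
  have \<eta>: "\<eta> > 0"
    unfolding \<eta>_def min_less_iff_conj
    by (intro conjI divide_pos_pos mult_pos_pos \<rho> \<kappa>4 k(1) pos) simp_all
  have ratio: "t / (frob X + 1) * frob X \<le> t" if "t \<ge> 0" for t X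
  proof -
    have "t * frob X \<le> t * (frob X + 1)"
      using that by (intro mult_left_mono) simp_all
    then show ?thesis
      using pos[of X] by (simp add: divide_le_eq add.commute)
  qed
  have \<rho>_small: "\<rho> * (2 / k * frob Y) \<le> \<kappa>4 / 2"
  proof -
    have "\<kappa>4 * k / (4 * m) * (2 / k * t) = \<kappa>4 / 2 / m * t" if "m > 0" for m t
      using k(1) that by (simp add: field_simps)
    then have "\<rho> * (2 / k * frob Y) = \<kappa>4 / 2 / (frob Y + 1) * frob Y"
      unfolding \<rho>_def using pos by blast
    then show ?thesis
      using ratio[of "\<kappa>4 / 2" Y] \<kappa>4 by simp
  qed
  have \<eta>K: "\<eta> * frob K \<le> \<rho> * k / 4"
  proof -
    have "\<eta> * frob K \<le> \<rho> * k / 4 / (frob K + 1) * frob K"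
      unfolding \<eta>_def divide_divide_eq_left by (intro mult_right_mono min.cobounded1 frob_ge_0)
    also have "\<dots> \<le> \<rho> * k / 4"
      using ratio[of "\<rho> * k / 4" K] \<rho> k(1) by simp
    finally show ?thesis .
  qed
  have \<eta>K_e: "\<eta> * frob (K_e M K) \<le> \<kappa>4 / 4"
  proof -
    have "\<eta> * frob (K_e M K) \<le> \<kappa>4 / 4 / (frob (K_e M K) + 1) * frob (K_e M K)"
      unfolding \<eta>_def divide_divide_eq_left by (intro mult_right_mono min.cobounded2 frob_ge_0)
    also have "\<dots> \<le> \<kappa>4 / 4"
      using ratio[of "\<kappa>4 / 4" "K_e M K"] \<kappa>4 by simp
    finally show ?thesis .
  qed
  have P0_pos: "pos_def n P\<^sub>0"
    unfolding P\<^sub>0_def using Pc(1) \<rho> by (rule pos_def_smult)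
  have Pe_pos: "pos_def (M * n) P\<^sub>e" and Se_pos: "pos_def (M * n) S\<^sub>e" and Re_pos: "pos_def (M * n) R\<^sub>e"
    unfolding P\<^sub>e_def S\<^sub>e_def R\<^sub>e_def using P S R s by (auto intro: pos_def_diag_kron)
  have Q: "Q > 0"
    using Cu eps_pos by (simp add: Q_def)
  have Q_eps: "eps \<delta> r M * Q = Cu + 1"
    using eps_pos by (simp add: Q_def)
  note Pc_dims = pos_def_dest(2,3)[OF Pc(1)]
  show thesis
  proof (rule that[OF P0_pos Pe_pos Se_pos Re_pos Q, of N1])
    fix N :: nat assume "N > N1"
    then have "2 * \<alpha> / \<eta> \<le> real N"
      unfolding N1_def by linarith
    then have "2 * \<alpha> \<le> \<eta> * real N"
      using \<eta> by (simp add: divide_le_eq mult.commute)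
    moreover have N: "real N > 0"
      using \<open>N > N1\<close> by simp
    moreover have "1 \<le> pi\<^sup>2"
      using pi_gt3 by (intro one_le_power) simp
    then have "\<eta> * real N * 1 \<le> \<eta> * real N * pi\<^sup>2"
      using \<eta> by (intro mult_left_mono) simp_all
    ultimately have coeff: "2 * \<alpha> / (real N * pi\<^sup>2) \<le> \<eta>"
      by (simp add: pos_divide_le_eq mult.assoc)
    interpret loop_data n M N \<delta> r Q \<alpha> \<alpha> A B C L K P\<^sub>0 P\<^sub>e S\<^sub>e R\<^sub>e
      using A B C L K M pos_def_dest[OF P0_pos] pos_def_dest[OF Pe_pos] pos_def_dest[OF Se_pos]
        pos_def_dest[OF Re_pos] by unfold_locales blast+
    have W_eq: "W = Acl"
      by (simp only: W_def Acl_def)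
    have "v \<bullet> (\<Omega> *\<^sub>v v) < 0" if v: "dim_vec v = n + (M * n + (M * n + 1))"
      and nz: "v \<noteq> 0\<^sub>v (n + (M * n + (M * n + 1)))" for v
    proof -
      obtain x v1 where v1: "v = x @\<^sub>v v1" "dim_vec x = n" "dim_vec v1 = M * n + (M * n + 1)"
        using v by (rule append_vec_exhaust)
      obtain z v2 where v2: "v1 = z @\<^sub>v v2" "dim_vec z = M * n" "dim_vec v2 = M * n + 1"
        using v1(3) by (rule append_vec_exhaust)
      obtain w u where v3: "v2 = w @\<^sub>v u" "dim_vec w = M * n" "dim_vec u = 1"
        using v2(3) by (rule append_vec_exhaust)
      note d = v1(2) v2(2) v3(2,3)
      have "nsq v \<noteq> 0"
        using nz v nsq_eq_0_iff by metis
      then have "0 < nsq v"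
        using nsq_ge_0[of v] by linarith
      then have nz': "0 < nsq x + nsq z + nsq w + nsq u"
        by (simp add: v1(1) v2(1) v3(1) nsq_append add.assoc)
      have state: "2 * (x \<bullet> (P\<^sub>0 *\<^sub>v (Acl *\<^sub>v x))) + 2 * \<delta> * (x \<bullet> (P\<^sub>0 *\<^sub>v x)) \<le> - (\<rho> * k) * nsq x"
      proof -
        have "x \<bullet> ((Pc * Acl + Acl\<^sup>T * Pc - (- 2 * \<delta>) \<cdot>\<^sub>m Pc) *\<^sub>v x)
            = x \<bullet> ((Pc * Acl + Acl\<^sup>T * Pc) *\<^sub>v x) + 2 * \<delta> * (x \<bullet> (Pc *\<^sub>v x))"
          using d Pc_dims Acl by (subst minus_mv) (simp_all add: smult_mv sp_minus_right)
        also have "\<dots> = 2 * (x \<bullet> (Pc *\<^sub>v (Acl *\<^sub>v x))) + 2 * \<delta> * (x \<bullet> (Pc *\<^sub>v x))"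
          using lyapunov_form[OF pos_def_dest(1)[OF Pc(1)] Pc_dims Acl d(1)] by simp
        finally have "2 * (x \<bullet> (Pc *\<^sub>v (Acl *\<^sub>v x))) + 2 * \<delta> * (x \<bullet> (Pc *\<^sub>v x)) \<le> - k * nsq x"
          using k(2)[OF d(1)] by simp
        then have "\<rho> * (2 * (x \<bullet> (Pc *\<^sub>v (Acl *\<^sub>v x))) + 2 * \<delta> * (x \<bullet> (Pc *\<^sub>v x))) \<le> \<rho> * (- k * nsq x)"
          using \<rho> by (intro mult_left_mono) simp_all
        then show ?thesis
          unfolding P\<^sub>0_def using d Pc_dims Acl by (simp add: smult_mv algebra_simps)
      qed
      have cross: "2 * (x \<bullet> (P\<^sub>0 *\<^sub>v (B *\<^sub>v (K_e M K *\<^sub>v z)))) \<le> \<rho> * k / 2 * nsq x + \<kappa>4 / 2 * nsq z"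
      proof -
        have "2 * (x \<bullet> (Y *\<^sub>v z)) \<le> k / 2 * nsq x + nsq (Y *\<^sub>v z) / (k / 2)"
          using k(1) d Pc_dims by (intro young) (simp_all add: Y_def)
        also have "nsq (Y *\<^sub>v z) / (k / 2) \<le> (frob Y * nsq z) / (k / 2)"
          using k(1) d K by (intro divide_right_mono nsq_mv_le) (simp_all add: Y_def)
        finally have "\<rho> * (2 * (x \<bullet> (Y *\<^sub>v z))) \<le> \<rho> * (k / 2 * nsq x + (frob Y * nsq z) / (k / 2))"
          using \<rho> by (intro mult_left_mono) simp_all
        also have "\<dots> = \<rho> * k / 2 * nsq x + \<rho> * (2 / k * frob Y) * nsq z"
          by (simp add: algebra_simps)
        also have "\<dots> \<le> \<rho> * k / 2 * nsq x + \<kappa>4 / 2 * nsq z"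
          by (intro add_left_mono mult_right_mono \<rho>_small) simp
        finally have "\<rho> * (2 * (x \<bullet> (Y *\<^sub>v z))) \<le> \<rho> * k / 2 * nsq x + \<kappa>4 / 2 * nsq z" .
        moreover have "x \<bullet> (P\<^sub>0 *\<^sub>v (B *\<^sub>v (K_e M K *\<^sub>v z))) = \<rho> * (x \<bullet> (Y *\<^sub>v z))"
          unfolding P\<^sub>0_def Y_def using d Pc_dims B K by (simp add: smult_mv mult_mv)
        ultimately show ?thesis by simp
      qed
      have gain: "2 * \<alpha> / (real N * pi\<^sup>2) * nsq (K *\<^sub>v x) \<le> \<rho> * k / 4 * nsq x"
      proof -
        have "2 * \<alpha> / (real N * pi\<^sup>2) * nsq (K *\<^sub>v x) \<le> \<eta> * (frob K * nsq x)"
          using coeff \<eta> d K by (intro mult_mono nsq_mv_le) simp_all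
        also have "\<dots> \<le> \<rho> * k / 4 * nsq x"
          unfolding mult.assoc[symmetric] by (intro mult_right_mono \<eta>K) simp
        finally show ?thesis .
      qed
      have gain_e: "2 * \<alpha> / (real N * pi\<^sup>2) * nsq (K_e M K *\<^sub>v z) \<le> \<kappa>4 / 4 * nsq z"
      proof -
        have "2 * \<alpha> / (real N * pi\<^sup>2) * nsq (K_e M K *\<^sub>v z) \<le> \<eta> * (frob (K_e M K) * nsq z)"
          using coeff \<eta> d K by (intro mult_mono nsq_mv_le) simp_all
        also have "\<dots> \<le> \<kappa>4 / 4 * nsq z"
          unfolding mult.assoc[symmetric] by (intro mult_right_mono \<eta>K_e) simp
        finally show ?thesis .
      qed
      have "v \<bullet> (\<Omega> *\<^sub>v v) \<le> - (\<rho> * k) * nsq x + (\<rho> * k / 2 * nsq x + \<kappa>4 / 2 * nsq z)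
          + \<rho> * k / 4 * nsq x + \<kappa>4 / 4 * nsq z + (- \<kappa>4 * (nsq z + nsq w) + Cu * nsq u) - (Cu + 1) * nsq u"
        unfolding v1(1) v2(1) v3(1) \<Omega>_form[OF d] W_eq Q_eps
        using state cross gain gain_e cascade[OF d(2-4)] unfolding P\<^sub>e_def S\<^sub>e_def R\<^sub>e_def \<kappa>4_def by linarith
      also have "\<dots> = - (\<rho> * k / 4 * nsq x + \<kappa>4 / 4 * nsq z + \<kappa>4 * nsq w + nsq u)"
        by (simp add: algebra_simps)
      also have "\<dots> < 0"
      proof -
        let ?m = "min (min (\<rho> * k / 4) (\<kappa>4 / 4)) 1"
        have "0 < ?m * (nsq x + nsq z + nsq w + nsq u)"
          using \<rho> k(1) \<kappa>4 nz' by simp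
        also have "\<dots> = ?m * nsq x + ?m * nsq z + ?m * nsq w + ?m * nsq u"
          by (simp only: distrib_left)
        also have "\<dots> \<le> \<rho> * k / 4 * nsq x + \<kappa>4 / 4 * nsq z + \<kappa>4 * nsq w + 1 * nsq u"
          using \<kappa>4 by (intro add_mono mult_right_mono) simp_all
        finally show ?thesis by simp
      qed
      finally show ?thesis .
    qed
    then show "neg_def (n + M * n + M * n + 1) (Psi0 \<delta> r M N A B C L K P\<^sub>0 P\<^sub>e S\<^sub>e R\<^sub>e Q \<alpha> \<alpha>
      + (r / real M)\<^sup>2 \<cdot>\<^sub>m ((Lambda0 M A L C)\<^sup>T * R\<^sub>e * Lambda0 M A L C))"
      unfolding \<Lambda>_def[symmetric] \<Omega>_def[symmetric] neg_def_def
      using \<Omega>_sym \<Omega>_dims by (auto intro!: carrier_matI dest!: carrier_vecD simp: add.assoc)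
  qed
qed

theorem proposition1:
  fixes q \<delta> h r :: real and c :: "real \<Rightarrow> real" and N0 M :: nat
    and L0 K0 P S R :: "real mat"
  assumes "\<delta> > 0"
    and "L2_01 c"
    and "\<And>n. n > N0 \<Longrightarrow> - lam n + q < - \<delta>"
    and "\<And>n. n \<le> N0 \<Longrightarrow> c_coeff c n \<noteq> 0"
    and "L0 \<in> carrier_mat (N0 + 1) 1"
    and "K0 \<in> carrier_mat 1 (N0 + 1)"
    and "\<exists>P\<^sub>o. pos_def (N0 + 1) P\<^sub>o \<and>
           neg_def (N0 + 1)
             (P\<^sub>o * (A0 q N0 - L0 * C0 c N0) + (A0 q N0 - L0 * C0 c N0)\<^sup>T * P\<^sub>o
              - (- 2 * \<delta>) \<cdot>\<^sub>m P\<^sub>o)"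
    and "\<exists>P\<^sub>c. pos_def (N0 + 1) P\<^sub>c \<and>
           neg_def (N0 + 1)
             (P\<^sub>c * (A0 q N0 - B0 N0 * K0) + (A0 q N0 - B0 N0 * K0)\<^sup>T * P\<^sub>c
              - (- 2 * \<delta>) \<cdot>\<^sub>m P\<^sub>c)"
    and "h > 0"
    and "pos_def (N0 + 1) P" and "pos_def (N0 + 1) S" and "pos_def (N0 + 1) R"
    and "neg_def (2 * (N0 + 1)) (delay_LMI \<delta> h (A0 q N0) L0 (C0 c N0) P S R)"
    and "r > 0"
    and "real M > r / h"
  shows "\<exists>Nstar \<ge> N0. \<forall>N > Nstar.
           \<exists>P\<^sub>0 P\<^sub>e S\<^sub>e R\<^sub>e Q \<alpha> \<alpha>\<^sub>1.
             pos_def (N0 + 1) P\<^sub>0 \<and>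
             pos_def (M * (N0 + 1)) P\<^sub>e \<and> pos_def (M * (N0 + 1)) S\<^sub>e \<and> pos_def (M * (N0 + 1)) R\<^sub>e \<and>
             Q > 0 \<and> \<alpha> > 0 \<and> \<alpha>\<^sub>1 > 0 \<and>
             neg_def 3 (tail_LMI q \<delta> c N Q \<alpha> \<alpha>\<^sub>1) \<and>
             neg_def ((N0 + 1) + M * (N0 + 1) + M * (N0 + 1) + 1)
               (Psi0 \<delta> r M N (A0 q N0) (B0 N0) (C0 c N0) L0 K0 P\<^sub>0 P\<^sub>e S\<^sub>e R\<^sub>e Q \<alpha> \<alpha>\<^sub>1
                + (r / real M)\<^sup>2 \<cdot>\<^sub>m ((Lambda0 M (A0 q N0) L0 (C0 c N0))\<^sup>T * R\<^sub>e
                                       * Lambda0 M (A0 q N0) L0 (C0 c N0)))"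
proof -
  let ?A = "A0 q N0" and ?B = "B0 N0" and ?C = "C0 c N0" and ?n = "N0 + 1"
  have A: "dim_row ?A = ?n" "dim_col ?A = ?n" and B: "dim_row ?B = ?n" "dim_col ?B = 1"
    and C: "dim_row ?C = 1" "dim_col ?C = ?n"
    by (simp_all add: A0_def B0_def C0_def)
  have L: "dim_row L0 = ?n" "dim_col L0 = 1" and K: "dim_row K0 = 1" "dim_col K0 = ?n"
    using assms(5,6) by auto
  have M: "real M > 0"
    using assms(9,14,15) by (smt (verit) divide_pos_pos)
  then have rM: "r / real M \<le> h"
    using assms(9,15) by (simp add: field_simps)
  obtain Pc where Pc: "pos_def ?n Pc"
    "neg_def ?n (Pc * (?A - ?B * K0) + (?A - ?B * K0)\<^sup>T * Pc - (- 2 * \<delta>) \<cdot>\<^sub>m Pc)"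
    using assms(8) by blast
  have M0: "M > 0" using M by simp
  have four: "(0::real) < 4" by simp
  obtain P\<^sub>0 P\<^sub>e S\<^sub>e R\<^sub>e Q N1 where pos: "pos_def ?n P\<^sub>0" "pos_def (M * ?n) P\<^sub>e" "pos_def (M * ?n) S\<^sub>e"
      "pos_def (M * ?n) R\<^sub>e" "Q > 0"
    and loop: "\<And>N. N > N1 \<Longrightarrow> neg_def (?n + M * ?n + M * ?n + 1)
      (Psi0 \<delta> r M N ?A ?B ?C L0 K0 P\<^sub>0 P\<^sub>e S\<^sub>e R\<^sub>e Q 4 4
      + (r / real M)\<^sup>2 \<cdot>\<^sub>m ((Lambda0 M ?A L0 ?C)\<^sup>T * R\<^sub>e * Lambda0 M ?A L0 ?C))"
    using loop_LMI_feasible[OF A B C L K M0 Pc assms(10-13) assms(14) rM assms(1) four] by blast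
  define I where "I = integral\<^sup>L (lebesgue_on {0<..<1}) (\<lambda>x. (c x)\<^sup>2)"
  define N2 where "N2 = nat \<lceil>2 * (q + \<delta> + Q * I / 2)\<rceil>"
  have tail: "neg_def 3 (tail_LMI q \<delta> c N Q 4 4)" if "N > N2" for N
  proof (rule tail_LMI_neg_def)
    have "2 * (q + \<delta> + Q * I / 2) \<le> real N"
      using that unfolding N2_def by linarith
    also have "real N < real (N + 1)" by simp
    also have "\<dots> \<le> lam (N + 1)"
    proof -
      have "1 * 1 \<le> real (N + 1) * pi\<^sup>2"
        using pi_gt3 by (intro mult_mono one_le_power) simp_all
      then have "real (N + 1) * 1 \<le> real (N + 1) * (real (N + 1) * pi\<^sup>2)"
        by (intro mult_left_mono) simp_all
      then show ?thesis
        by (simp add: lam_def power2_eq_square mult.assoc)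
    qed
    finally have "q + \<delta> + Q * I / 2 < lam (N + 1) / 2" by simp
    moreover have "Q * tail_norm_sq c N \<le> Q * I"
      using tail_norm_sq_le[OF assms(2)] pos(5) unfolding I_def by (intro mult_left_mono) simp_all
    ultimately show "- lam (N + 1) / 2 + q + \<delta> + Q * tail_norm_sq c N / 2 < 0"
      by simp
  qed
  show ?thesis
  proof (intro exI[of _ "max N0 (max N1 N2)"] conjI allI impI)
    fix N assume "N > max N0 (max N1 N2)"
    then have "N > N1" "N > N2" by simp_all
    then show "\<exists>P\<^sub>0 P\<^sub>e S\<^sub>e R\<^sub>e Q \<alpha> \<alpha>\<^sub>1.
             pos_def (N0 + 1) P\<^sub>0 \<and>
             pos_def (M * (N0 + 1)) P\<^sub>e \<and> pos_def (M * (N0 + 1)) S\<^sub>e \<and> pos_def (M * (N0 + 1)) R\<^sub>e \<and>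
             Q > 0 \<and> \<alpha> > 0 \<and> \<alpha>\<^sub>1 > 0 \<and>
             neg_def 3 (tail_LMI q \<delta> c N Q \<alpha> \<alpha>\<^sub>1) \<and>
             neg_def ((N0 + 1) + M * (N0 + 1) + M * (N0 + 1) + 1)
               (Psi0 \<delta> r M N (A0 q N0) (B0 N0) (C0 c N0) L0 K0 P\<^sub>0 P\<^sub>e S\<^sub>e R\<^sub>e Q \<alpha> \<alpha>\<^sub>1
                + (r / real M)\<^sup>2 \<cdot>\<^sub>m ((Lambda0 M (A0 q N0) L0 (C0 c N0))\<^sup>T * R\<^sub>e
                                       * Lambda0 M (A0 q N0) L0 (C0 c N0)))"
      using pos four tail[of N] loop[of N] by blast
  qed simp
qed

end
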